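(* Let $L=L_{\lambda_c}$ be the operator of the context and suppose that condition (D) and the Hopf conditions (H1)–(H5) hold. Then there exist constants $\omega_0,C>0$, depending only on the coefficients of $L$, such that for every $\tilde\omega\in\mathbb R$ with $|\tilde\omega|\ge\omega_0$, the number $i\tilde\omega$ lies in the resolvent set of $L$ and $$\|(i\tilde\omega\,\mathrm{Id}-L)^{-1}\|_{\mathcal L(L^2)}\le\frac{C}{|\tilde\omega|}.$$
   Context: $\mathcal H^s$ is the space of pairs of $2\pi$-periodic (complex-valued) zero-mean functions in the Sobolev space $H^s_{\rm per}(0,2\pi)$; $\mathcal H=\mathcal H^0$ with the $L^2$ norm, and $\mathcal L(L^2)$ denotes bounded operators on $\mathcal H$ with the operator norm. Let $m_L\ge1$ be an integer and $b_{i,k}=b_{i,k}(\lambda)\in\mathbb R$ smooth in $\lambda\in\mathbb R$. $L_\lambda=(L_{ij})$ is the unbounded operator on $\mathcal H$ with domain $\mathcal H^{2m_L}$ given by $$L_{11}=\sum_{k=0}^{m_L}b_{1,2k}\partial_x^{2k},\quad L_{12}=\sum_{k=0}^{m_L}b_{1,2k+1}\partial_x^{2k+1},\quad L_{21}=\sum_{k=0}^{m_L}b_{2,2k+1}\partial_x^{2k+1},\quad L_{22}=\sum_{k=0}^{m_L}b_{2,2k}\partial_x^{2k}.$$ Its Fourier symbol is $$M_m=\sum_{k=0}^{m_L}(-1)^k\begin{bmatrix}b_{1,2k}m^{2k}& i\,b_{1,2k+1}m^{2k+1}\\ i\,b_{2,2k+1}m^{2k+1}& b_{2,2k}m^{2k}\end{bmatrix},\quad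 m\in\mathbb Z\setminus\{0\}.$$ **(D)** $b_{1,2m_L}\ne0$, $b_{2,2m_L}\ne0$, $b_{1,2m_L+1}=b_{2,2m_L+1}=0$. **Hopf conditions.** There exist an integer $m_c\ge1$ and $\lambda_c\in\mathbb R$ with: (H1) $\operatorname{tr}M_{m_c}(\lambda_c)=0$; (H2) $\det M_m(\lambda_c)>0$ for all $m\ne0$; (H3) $\frac{d}{d\lambda}\operatorname{tr}M_{m_c}(\lambda_c)\ne0$; (H4) $\operatorname{tr}M_m(\lambda_c)<0$ for all $m\ne0,\pm m_c$; (H5) $\liminf_{m\to\infty}\det M_m(\lambda_c)/|\operatorname{tr}M_m(\lambda_c)|>0$. *)

theory Defs
  imports "HOL-Analysis.Analysis"
begin

section \<open>The space of periodic zero-mean square-integrable functions\<close>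

abbreviation period_measure :: "real measure"
  where "period_measure \<equiv> lebesgue_on {0..2*pi}"

definition periodic :: "(real \<Rightarrow> complex) \<Rightarrow> bool"
  where "periodic f \<longleftrightarrow> (\<forall>x. f (x + 2*pi) = f x)"

definition zero_mean_L2 :: "(real \<Rightarrow> complex) \<Rightarrow> bool"
  where "zero_mean_L2 f \<longleftrightarrow>
    periodic f \<and> f \<in> borel_measurable period_measure \<and>
    integrable period_measure (\<lambda>x. (cmod (f x))\<^sup>2) \<and>
    integral\<^sup>L period_measure f = 0"

definition L2_eq :: "(real \<Rightarrow> complex) \<Rightarrow> (real \<Rightarrow> complex) \<Rightarrow> bool"
  where "L2_eq f g \<longleftrightarrow>
    zero_mean_L2 f \<and> zero_mean_L2 g \<and> (AE x in period_measure. f x = g x)"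

interpretation period_measure: finite_measure period_measure
  by (simp add: finite_measure_lebesgue_on)

lemma zero_mean_L2_mult_integrable:
  assumes "zero_mean_L2 f" "zero_mean_L2 g"
  shows "integrable period_measure (\<lambda>x. f x * cnj (g x))"
proof (rule Bochner_Integration.integrable_bound)
  have [measurable]: "f \<in> borel_measurable period_measure" "g \<in> borel_measurable period_measure"
    using assms by (auto simp: zero_mean_L2_def)
  show "integrable period_measure (\<lambda>x. (cmod (f x))\<^sup>2 + (cmod (g x))\<^sup>2)"
    using assms by (auto simp: zero_mean_L2_def)
  show "(\<lambda>x. f x * cnj (g x)) \<in> borel_measurable period_measure"
    by (intro borel_measurable_times borel_measurable_continuous_on[where f=cnj])
       (auto intro: continuous_intros)
  have "cmod (f x * cnj (g x)) \<le> (cmod (f x))\<^sup>2 + (cmod (g x))\<^sup>2" for x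
  proof -
    have "2 * (cmod (f x) * cmod (g x)) \<le> (cmod (f x))\<^sup>2 + (cmod (g x))\<^sup>2"
      using sum_squares_bound[of "cmod (f x)" "cmod (g x)"] by simp
    moreover have "0 \<le> cmod (f x) * cmod (g x)" by simp
    ultimately have "cmod (f x) * cmod (g x) \<le> (cmod (f x))\<^sup>2 + (cmod (g x))\<^sup>2"
      by linarith
    then show ?thesis by (simp add: norm_mult)
  qed
  then show "AE x in period_measure. norm (f x * cnj (g x))
      \<le> norm ((cmod (f x))\<^sup>2 + (cmod (g x))\<^sup>2)"
    by (intro AE_I2) (metis abs_of_nonneg add_nonneg_nonneg real_norm_def zero_le_power2)
qed

lemma zero_mean_L2_integrable:
  assumes "zero_mean_L2 f"
  shows "integrable period_measure f"
proof (rule Bochner_Integration.integrable_bound)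
  show "integrable period_measure (\<lambda>x. 1 + (cmod (f x))\<^sup>2)"
    using assms by (auto simp: zero_mean_L2_def)
  show "f \<in> borel_measurable period_measure"
    using assms by (auto simp: zero_mean_L2_def)
  have "cmod (f x) \<le> 1 + (cmod (f x))\<^sup>2" for x
  proof -
    have "2 * cmod (f x) \<le> 1 + (cmod (f x))\<^sup>2"
      using sum_squares_bound[of 1 "cmod (f x)"] by simp
    then show ?thesis using norm_ge_zero[of "f x"] by linarith
  qed
  then show "AE x in period_measure. norm (f x) \<le> norm (1 + (cmod (f x))\<^sup>2)"
    by (intro AE_I2) (metis abs_of_nonneg add_nonneg_nonneg real_norm_def zero_le_power2 zero_le_one)
qed

lemma zero_mean_L2_zero: "zero_mean_L2 (\<lambda>x. 0)"
  by (simp add: zero_mean_L2_def periodic_def)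

lemma zero_mean_L2_cmult:
  assumes "zero_mean_L2 f"
  shows "zero_mean_L2 (\<lambda>x. c * f x)"
  using assms by (auto simp: zero_mean_L2_def periodic_def norm_mult power_mult_distrib)

lemma zero_mean_L2_add:
  assumes f: "zero_mean_L2 f" and g: "zero_mean_L2 g"
  shows "zero_mean_L2 (\<lambda>x. f x + g x)"
proof -
  have [measurable]: "f \<in> borel_measurable period_measure" "g \<in> borel_measurable period_measure"
    using assms by (auto simp: zero_mean_L2_def)
  have "integrable period_measure (\<lambda>x. (cmod (f x + g x))\<^sup>2)"
  proof (rule Bochner_Integration.integrable_bound)
    show "integrable period_measure (\<lambda>x. 2 * (cmod (f x))\<^sup>2 + 2 * (cmod (g x))\<^sup>2)"
      using assms by (auto simp: zero_mean_L2_def)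
    have "(cmod (f x + g x))\<^sup>2 \<le> 2 * (cmod (f x))\<^sup>2 + 2 * (cmod (g x))\<^sup>2" for x
    proof -
      have "(cmod (f x + g x))\<^sup>2 \<le> (cmod (f x) + cmod (g x))\<^sup>2"
        by (intro power_mono norm_triangle_ineq) auto
      also have "\<dots> \<le> 2 * (cmod (f x))\<^sup>2 + 2 * (cmod (g x))\<^sup>2"
        using sum_squares_bound[of "cmod (f x)" "cmod (g x)"] by (simp add: power2_sum)
      finally show ?thesis .
    qed
    then show "AE x in period_measure. norm ((cmod (f x + g x))\<^sup>2)
        \<le> norm (2 * (cmod (f x))\<^sup>2 + 2 * (cmod (g x))\<^sup>2)"
      by (intro AE_I2) simp
  qed measurable
  then show ?thesis
    using assms zero_mean_L2_integrable[OF f] zero_mean_L2_integrable[OF g]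
    by (auto simp: zero_mean_L2_def periodic_def)
qed

lemma part_equivp_L2_eq: "part_equivp L2_eq"
proof (rule part_equivpI)
  show "\<exists>f. L2_eq f f"
    by (rule exI[of _ "\<lambda>x. 0"]) (simp add: L2_eq_def zero_mean_L2_zero)
  show "symp L2_eq"
    by (rule sympI) (auto simp: L2_eq_def elim: eventually_mono)
  show "transp L2_eq"
    by (rule transpI) (auto simp: L2_eq_def elim: eventually_elim2)
qed

quotient_type L2per = "real \<Rightarrow> complex" / partial: L2_eq
  by (rule part_equivp_L2_eq)

lift_definition scaleC :: "complex \<Rightarrow> L2per \<Rightarrow> L2per" (infixr "*\<^sub>C" 75)
  is "\<lambda>c f x. c * f x"
  by (auto simp: L2_eq_def zero_mean_L2_cmult elim: eventually_mono)

instantiation L2per :: real_inner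
begin

lift_definition zero_L2per :: L2per is "\<lambda>x. 0"
  by (simp add: L2_eq_def zero_mean_L2_zero)

lift_definition plus_L2per :: "L2per \<Rightarrow> L2per \<Rightarrow> L2per" is "\<lambda>f g x. f x + g x"
  by (auto simp: L2_eq_def zero_mean_L2_add elim: eventually_elim2)

definition scaleR_L2per :: "real \<Rightarrow> L2per \<Rightarrow> L2per"
  where "scaleR_L2per r u = complex_of_real r *\<^sub>C u"

definition uminus_L2per :: "L2per \<Rightarrow> L2per"
  where "uminus_L2per u = (-1) *\<^sub>C u"

definition minus_L2per :: "L2per \<Rightarrow> L2per \<Rightarrow> L2per"
  where "minus_L2per u v = u + (- v)"

lift_definition inner_L2per :: "L2per \<Rightarrow> L2per \<Rightarrow> real"
  is "\<lambda>f g. Re (integral\<^sup>L period_measure (\<lambda>x. f x * cnj (g x)))"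
proof -
  fix f f' g g' assume *: "L2_eq f f'" "L2_eq g g'"
  have "integral\<^sup>L period_measure (\<lambda>x. f x * cnj (g x)) =
        integral\<^sup>L period_measure (\<lambda>x. f' x * cnj (g' x))"
  proof (rule integral_cong_AE)
    show "(\<lambda>x. f x * cnj (g x)) \<in> borel_measurable period_measure"
      "(\<lambda>x. f' x * cnj (g' x)) \<in> borel_measurable period_measure"
      using * by (auto simp: L2_eq_def intro!: borel_measurable_integrable
          zero_mean_L2_mult_integrable)
    show "AE x in period_measure. f x * cnj (g x) = f' x * cnj (g' x)"
      using * by (auto simp: L2_eq_def elim: eventually_elim2)
  qed
  then show "Re (integral\<^sup>L period_measure (\<lambda>x. f x * cnj (g x))) =
        Re (integral\<^sup>L period_measure (\<lambda>x. f' x * cnj (g' x)))" by simp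
qed

definition norm_L2per :: "L2per \<Rightarrow> real"
  where "norm_L2per u = sqrt (inner u u)"

definition dist_L2per :: "L2per \<Rightarrow> L2per \<Rightarrow> real"
  where "dist_L2per u v = norm (u - v)"

definition sgn_L2per :: "L2per \<Rightarrow> L2per"
  where "sgn_L2per u = inverse (norm u) *\<^sub>R u"

definition uniformity_L2per :: "(L2per \<times> L2per) filter"
  where "uniformity_L2per = (INF e\<in>{0<..}. principal {(u, v). dist u v < e})"

definition open_L2per :: "L2per set \<Rightarrow> bool"
  where "open_L2per U \<longleftrightarrow>
    (\<forall>u\<in>U. eventually (\<lambda>(u', v). u' = u \<longrightarrow> v \<in> U) uniformity)"

instance
proof
  fix u v w :: L2per and a b :: real and U :: "L2per set"
  show "u + v + w = u + (v + w)"
    by transfer (auto simp: L2_eq_def zero_mean_L2_add add.assoc)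
  show "u + v = v + u"
    by transfer (auto simp: L2_eq_def zero_mean_L2_add add.commute)
  show "0 + u = u"
    by transfer (auto simp: L2_eq_def)
  show "- u + u = 0"
    unfolding uminus_L2per_def
    by transfer (auto simp: L2_eq_def zero_mean_L2_zero)
  show "u - v = u + - v"
    by (simp add: minus_L2per_def)
  show "a *\<^sub>R (u + v) = a *\<^sub>R u + a *\<^sub>R v"
    unfolding scaleR_L2per_def
    by transfer (auto simp: L2_eq_def distrib_left intro!: zero_mean_L2_add zero_mean_L2_cmult)
  show "(a + b) *\<^sub>R u = a *\<^sub>R u + b *\<^sub>R u"
    unfolding scaleR_L2per_def
    by transfer (auto simp: L2_eq_def distrib_right
        intro!: zero_mean_L2_add zero_mean_L2_cmult)
  show "a *\<^sub>R b *\<^sub>R u = (a * b) *\<^sub>R u"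
    unfolding scaleR_L2per_def
    by transfer (auto simp: L2_eq_def mult.assoc intro!: zero_mean_L2_cmult)
  show "1 *\<^sub>R u = u"
    unfolding scaleR_L2per_def
    by transfer (auto simp: L2_eq_def)
  show "sgn u = inverse (norm u) *\<^sub>R u"
    by (simp add: sgn_L2per_def)
  show "dist u v = norm (u - v)"
    by (simp add: dist_L2per_def)
  show "uniformity = (INF e\<in>{0<..}. principal {(u :: L2per, v). dist u v < e})"
    by (simp add: uniformity_L2per_def)
  show "open U \<longleftrightarrow> (\<forall>u\<in>U. eventually (\<lambda>(u', v). u' = u \<longrightarrow> v \<in> U) uniformity)"
    by (simp add: open_L2per_def)
  show "inner u v = inner v u"
  proof transfer
    fix f g :: "real \<Rightarrow> complex"
    have "integral\<^sup>L period_measure (\<lambda>x. g x * cnj (f x)) =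
          integral\<^sup>L period_measure (\<lambda>x. cnj (f x * cnj (g x)))"
      by (simp add: mult.commute)
    also have "\<dots> = cnj (integral\<^sup>L period_measure (\<lambda>x. f x * cnj (g x)))"
      by (rule Bochner_Integration.integral_cnj)
    finally show "Re (integral\<^sup>L period_measure (\<lambda>x. f x * cnj (g x))) =
        Re (integral\<^sup>L period_measure (\<lambda>x. g x * cnj (f x)))" by simp
  qed
  show "inner (u + v) w = inner u w + inner v w"
    by transfer (simp add: L2_eq_def distrib_right zero_mean_L2_mult_integrable)
  show "inner (a *\<^sub>R u) v = a * inner u v"
    unfolding scaleR_L2per_def by transfer (simp add: mult.assoc)
  have sq: "Re (integral\<^sup>L period_measure (\<lambda>x. f x * cnj (f x))) =
      integral\<^sup>L period_measure (\<lambda>x. (cmod (f x))\<^sup>2)" for f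
    by (simp only: complex_norm_square[symmetric] integral_complex_of_real Re_complex_of_real)
  show "0 \<le> inner u u"
    by transfer (simp add: sq)
  show "inner u u = 0 \<longleftrightarrow> u = 0"
  proof transfer
    fix f assume f: "L2_eq f f"
    then have "integral\<^sup>L period_measure (\<lambda>x. (cmod (f x))\<^sup>2) = 0 \<longleftrightarrow>
      (AE x in period_measure. (cmod (f x))\<^sup>2 = 0)"
      by (intro integral_nonneg_eq_0_iff_AE) (auto simp: L2_eq_def zero_mean_L2_def)
    then show "Re (integral\<^sup>L period_measure (\<lambda>x. f x * cnj (f x))) = 0 \<longleftrightarrow> L2_eq f (\<lambda>x. 0)"
      unfolding sq using f by (simp add: L2_eq_def zero_mean_L2_zero)
  qed
  show "norm u = sqrt (inner u u)"
    by (simp add: norm_L2per_def)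
qed

end

section \<open>Weak derivatives and Sobolev spaces\<close>

definition iter_deriv :: "nat \<Rightarrow> (real \<Rightarrow> 'a::real_normed_vector) \<Rightarrow> real \<Rightarrow> 'a"
  where "iter_deriv n f = ((\<lambda>g x. vector_derivative g (at x)) ^^ n) f"

definition smooth :: "(real \<Rightarrow> 'a::real_normed_vector) \<Rightarrow> bool"
  where "smooth f \<longleftrightarrow> (\<forall>n x. iter_deriv n f differentiable (at x))"

lemma smooth_iter_deriv_measurable:
  fixes \<phi> :: "real \<Rightarrow> complex"
  assumes "smooth \<phi>"
  shows "iter_deriv n \<phi> \<in> borel_measurable period_measure"
  using assms
  by (intro continuous_imp_measurable_on_sets_lebesgue continuous_at_imp_continuous_on ballI
      differentiable_imp_continuous_within) (auto simp: smooth_def)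

text \<open>
  \<open>weak_deriv k u v\<close> says that \<open>v\<close> is the \<open>k\<close>-th distributional derivative of \<open>u\<close> on the circle.
\<close>

lift_definition weak_deriv :: "nat \<Rightarrow> L2per \<Rightarrow> L2per \<Rightarrow> bool"
  is "\<lambda>k f g. \<forall>\<phi>. smooth \<phi> \<and> periodic \<phi> \<longrightarrow>
    integral\<^sup>L period_measure (\<lambda>x. f x * iter_deriv k \<phi> x) =
    (-1) ^ k * integral\<^sup>L period_measure (\<lambda>x. g x * \<phi> x)"
proof -
  fix k f f' g g' assume *: "L2_eq f f'" "L2_eq g g'"
  have meas: "f \<in> borel_measurable period_measure" "f' \<in> borel_measurable period_measure"
     "g \<in> borel_measurable period_measure" "g' \<in> borel_measurable period_measure"
    using * by (auto simp: L2_eq_def zero_mean_L2_def)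
  have "integral\<^sup>L period_measure (\<lambda>x. f x * iter_deriv k \<phi> x) =
        integral\<^sup>L period_measure (\<lambda>x. f' x * iter_deriv k \<phi> x) \<and>
        integral\<^sup>L period_measure (\<lambda>x. g x * \<phi> x) =
        integral\<^sup>L period_measure (\<lambda>x. g' x * \<phi> x)" if "smooth \<phi>" for \<phi>
    using * meas smooth_iter_deriv_measurable[OF that, of k]
      smooth_iter_deriv_measurable[OF that, of 0]
    by (intro conjI integral_cong_AE borel_measurable_times)
       (auto simp: L2_eq_def iter_deriv_def elim: eventually_mono)
  then show "(\<forall>\<phi>. smooth \<phi> \<and> periodic \<phi> \<longrightarrow>
      integral\<^sup>L period_measure (\<lambda>x. f x * iter_deriv k \<phi> x) =
      (-1) ^ k * integral\<^sup>L period_measure (\<lambda>x. g x * \<phi> x)) \<longleftrightarrow>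
    (\<forall>\<phi>. smooth \<phi> \<and> periodic \<phi> \<longrightarrow>
      integral\<^sup>L period_measure (\<lambda>x. f' x * iter_deriv k \<phi> x) =
      (-1) ^ k * integral\<^sup>L period_measure (\<lambda>x. g' x * \<phi> x))"
    by auto
qed

definition sobolev :: "nat \<Rightarrow> L2per set"
  where "sobolev s = {u. \<forall>k\<le>s. \<exists>v. weak_deriv k u v}"

definition wderiv :: "nat \<Rightarrow> L2per \<Rightarrow> L2per"
  where "wderiv k u = (THE v. weak_deriv k u v)"

section \<open>Resolvents of unbounded operators\<close>

text \<open>
  The Hilbert space of pairs is \<open>L2per \<times> L2per\<close>, whose product norm is
  \<open>norm (u, v) = sqrt ((norm u)\<^sup>2 + (norm v)\<^sup>2)\<close>.  An unbounded operator is a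
  domain \<open>D\<close> together with a map \<open>A\<close>, only whose values on \<open>D\<close> matter.
\<close>

definition shifted :: "complex \<Rightarrow> (L2per \<times> L2per \<Rightarrow> L2per \<times> L2per) \<Rightarrow> L2per \<times> L2per \<Rightarrow> L2per \<times> L2per"
  where "shifted z A p = (z *\<^sub>C fst p, z *\<^sub>C snd p) - A p"

definition resolvent ::
  "(L2per \<times> L2per) set \<Rightarrow> (L2per \<times> L2per \<Rightarrow> L2per \<times> L2per) \<Rightarrow> complex \<Rightarrow> L2per \<times> L2per \<Rightarrow> L2per \<times> L2per"
  where "resolvent D A z = inv_into D (shifted z A)"

definition resolvent_set ::
  "(L2per \<times> L2per) set \<Rightarrow> (L2per \<times> L2per \<Rightarrow> L2per \<times> L2per) \<Rightarrow> complex set"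
  where "resolvent_set D A =
    {z. bij_betw (shifted z A) D UNIV \<and> bounded_linear (resolvent D A z)}"

section \<open>The operator, its symbol, and the Hopf conditions\<close>

text \<open>
  Throughout, \<open>a i k\<close> is the coefficient \<open>b\<^bsub>i,k\<^esub>\<close> at a fixed parameter value,
  for \<open>i \<in> {1, 2}\<close> and \<open>k \<le> 2 * mL + 1\<close>; other values of \<open>a\<close> are irrelevant.
\<close>

definition L_dom :: "nat \<Rightarrow> (L2per \<times> L2per) set"
  where "L_dom mL = sobolev (2*mL) \<times> sobolev (2*mL)"

text \<open>
  On \<open>L_dom mL\<close> the derivative of order \<open>2 * mL + 1\<close> need not exist, so the top off-diagonal terms
  are meaningful only when their coefficients vanish, which is part of \<open>cond_D\<close> below.
\<close>

definition L_op :: "nat \<Rightarrow> (nat \<Rightarrow> nat \<Rightarrow> real) \<Rightarrow> L2per \<times> L2per \<Rightarrow> L2per \<times> L2per"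
  where "L_op mL a = (\<lambda>(u, v).
    ((\<Sum>k\<le>mL. a 1 (2*k) *\<^sub>R wderiv (2*k) u) + (\<Sum>k\<le>mL. a 1 (2*k+1) *\<^sub>R wderiv (2*k+1) v),
     (\<Sum>k\<le>mL. a 2 (2*k+1) *\<^sub>R wderiv (2*k+1) u) + (\<Sum>k\<le>mL. a 2 (2*k) *\<^sub>R wderiv (2*k) v)))"

definition symb :: "nat \<Rightarrow> (nat \<Rightarrow> nat \<Rightarrow> real) \<Rightarrow> int \<Rightarrow> complex^2^2"
  where "symb mL a m = (\<Sum>k\<le>mL. (-1) ^ k *\<^sub>R
    vector [vector [of_real (a 1 (2*k)) * of_int m ^ (2*k),
                    \<i> * of_real (a 1 (2*k+1)) * of_int m ^ (2*k+1)],
            vector [\<i> * of_real (a 2 (2*k+1)) * of_int m ^ (2*k+1),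
                    of_real (a 2 (2*k)) * of_int m ^ (2*k)]])"

lemma symb_trace_det_real:
  "trace (symb mL a m) \<in> \<real>" "det (symb mL a m) \<in> \<real>"
proof -
  have diag: "symb mL a m $ 1 $ 1 \<in> \<real>" "symb mL a m $ 2 $ 2 \<in> \<real>"
    by (auto simp: symb_def complex_is_Real_iff simp flip: of_int_power)
  have offd: "Re (symb mL a m $ 1 $ 2) = 0" "Re (symb mL a m $ 2 $ 1) = 0"
    by (auto simp: symb_def complex_is_Real_iff simp flip: of_int_power of_int_mult)
  show "trace (symb mL a m) \<in> \<real>" using diag by (simp add: trace_def UNIV_2)
  show "det (symb mL a m) \<in> \<real>" using diag offd by (simp add: det_2 complex_is_Real_iff)
qed

text \<open>By the previous lemma taking real parts loses nothing.\<close>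

definition tr_symb :: "nat \<Rightarrow> (nat \<Rightarrow> nat \<Rightarrow> real) \<Rightarrow> int \<Rightarrow> real"
  where "tr_symb mL a m = Re (trace (symb mL a m))"

definition det_symb :: "nat \<Rightarrow> (nat \<Rightarrow> nat \<Rightarrow> real) \<Rightarrow> int \<Rightarrow> real"
  where "det_symb mL a m = Re (det (symb mL a m))"

definition cond_D :: "nat \<Rightarrow> (nat \<Rightarrow> nat \<Rightarrow> real) \<Rightarrow> bool"
  where "cond_D mL a \<longleftrightarrow>
    a 1 (2*mL) \<noteq> 0 \<and> a 2 (2*mL) \<noteq> 0 \<and> a 1 (2*mL+1) = 0 \<and> a 2 (2*mL+1) = 0"

text \<open>Here \<open>b \<lambda> i k\<close> is the coefficient \<open>b\<^bsub>i,k\<^esub>(\<lambda>)\<close>.\<close>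

definition hopf_conditions :: "nat \<Rightarrow> (real \<Rightarrow> nat \<Rightarrow> nat \<Rightarrow> real) \<Rightarrow> nat \<Rightarrow> real \<Rightarrow> bool"
  where "hopf_conditions mL b mc lc \<longleftrightarrow>
    tr_symb mL (b lc) (int mc) = 0 \<and>
    (\<forall>m. m \<noteq> 0 \<longrightarrow> det_symb mL (b lc) m > 0) \<and>
    deriv (\<lambda>l. tr_symb mL (b l) (int mc)) lc \<noteq> 0 \<and>
    (\<forall>m. m \<noteq> 0 \<and> m \<noteq> int mc \<and> m \<noteq> - int mc \<longrightarrow> tr_symb mL (b lc) m < 0) \<and>
    liminf (\<lambda>n. ereal (det_symb mL (b lc) (int n) / \<bar>tr_symb mL (b lc) (int n)\<bar>)) > 0"

end

theory Submission
  imports Defs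
begin

text \<open>
  On the Fourier side the operator acts on the modes of frequency \<open>m \<noteq> 0\<close> through the symbol \<open>M\<^sub>m\<close>,
  a \<open>2 \<times> 2\<close> matrix with real diagonal and purely imaginary off-diagonal entries.  A point
  \<open>\<i> * \<omega>\<close> of the imaginary axis therefore has distance at least \<open>max \<bar>\<omega>\<bar> \<bar>p\<bar>\<close> from each diagonal entry
  \<open>p\<close>.  By condition (D) the diagonal entries have order exactly \<open>2 * mL\<close> in \<open>m\<close>, while the
  off-diagonal ones have order at most \<open>2 * mL - 1\<close>.  At high frequencies the diagonal of
  \<open>\<i> * \<omega> - M\<^sub>m\<close> dominates because of \<open>\<bar>p\<bar>\<close>, and at the finitely many remaining frequencies it dominates
  because of \<open>\<bar>\<omega>\<bar>\<close>, once \<open>\<bar>\<omega>\<bar>\<close> is large (\<open>eventually_diagonally_dominant\<close>).  Diagonal dominance makes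
  \<open>\<i> * \<omega> - M\<^sub>m\<close> invertible with an inverse of size \<open>O(1 / \<bar>\<omega>\<bar>)\<close> uniformly in \<open>m\<close>, and of
  size \<open>O(\<bar>m\<bar> ^ (- 2 * mL))\<close> as \<open>\<bar>m\<bar> \<rightarrow> \<infinity>\<close>.  The first property is the resolvent estimate
  (\<open>L_op_resolvent_estimate\<close>), the second places the solution in the domain of the operator
  (\<open>L_op_resolvent_surj\<close>).

  The passage to Fourier coefficients rests on three facts about the Hilbert space.  Elements are
  determined by their coefficients (\<open>L2per_eqI\<close>); weak differentiation is multiplication by \<open>\<i> * m\<close>
  (\<open>weak_deriv_iff_coeff\<close>); and absolutely summable sequences are coefficient sequences
  (\<open>absolutely_summable_fourier_series\<close>).  The first two are proved by pairing an arbitrary \<open>L\<^sup>2\<close>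
  function with step functions and with smooth functions, respectively, whose Fourier series converge
  almost everywhere by an elementary telescoping argument and then in mean by Fatou's lemma
  (\<open>fourier_series_at_differentiable_point\<close>, \<open>fourier_series_converges_in_mean\<close>).
\<close>

section \<open>Square-integrable functions on a period and their Fourier coefficients\<close>

definition square_integrable :: "(real \<Rightarrow> complex) \<Rightarrow> bool"
  where "square_integrable f \<longleftrightarrow>
    f \<in> borel_measurable period_measure \<and> integrable period_measure (\<lambda>x. (cmod (f x))\<^sup>2)"

definition emode :: "int \<Rightarrow> real \<Rightarrow> complex"
  where "emode m x = cis (of_int m * x)"

definition fourier_coeff :: "(real \<Rightarrow> complex) \<Rightarrow> int \<Rightarrow> complex"
  where "fourier_coeff f m = integral\<^sup>L period_measure (\<lambda>x. f x * emode (- m) x) / (2 * pi)"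

definition fourier_sum :: "(int \<Rightarrow> complex) \<Rightarrow> int set \<Rightarrow> real \<Rightarrow> complex"
  where "fourier_sum c A x = (\<Sum>m\<in>A. c m * emode m x)"

lemma emode_0 [simp]: "emode 0 x = 1"
  by (simp add: emode_def)

lemma norm_emode [simp]: "cmod (emode m x) = 1"
  by (simp add: emode_def)

lemma emode_mult: "emode m x * emode n x = emode (m + n) x"
  by (simp add: emode_def cis_mult distrib_right)

lemma cnj_emode: "cnj (emode m x) = emode (- m) x"
  by (simp add: emode_def cis_cnj)

lemma continuous_emode: "continuous_on S (emode m)"
  unfolding emode_def by (intro continuous_intros)

lemma periodic_emode: "periodic (emode m)"
proof -
  have "cis (of_int m * (x + 2 * pi)) = cis (of_int m * x)" for x :: real
  proof -
    have "cis (2 * pi * of_int m) = 1" by (rule cis_multiple_2pi) simp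
    then show ?thesis by (simp add: distrib_left mult.commute flip: cis_mult)
  qed
  then show ?thesis by (simp add: periodic_def emode_def)
qed

lemma has_vector_derivative_emode:
  "(emode m has_vector_derivative \<i> * of_int m * emode m x) (at x)"
proof -
  have "((\<lambda>z. exp (\<i> * of_int m * z)) has_field_derivative
      \<i> * of_int m * exp (\<i> * of_int m * of_real x)) (at (of_real x))"
    by (auto intro!: derivative_eq_intros)
  from has_vector_derivative_real_field[OF this] show ?thesis
    by (simp add: emode_def[abs_def] cis_conv_exp mult_ac)
qed

lemma square_integrableD [dest]:
  assumes "square_integrable f"
  shows "f \<in> borel_measurable period_measure" "integrable period_measure (\<lambda>x. (cmod (f x))\<^sup>2)"
  using assms by (auto simp: square_integrable_def)

lemma square_integrable_mult:
  assumes "square_integrable f" "square_integrable g"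
  shows "integrable period_measure (\<lambda>x. f x * g x)"
proof (rule Bochner_Integration.integrable_bound)
  have [measurable]: "f \<in> borel_measurable period_measure" "g \<in> borel_measurable period_measure"
    using assms by auto
  show "integrable period_measure (\<lambda>x. (cmod (f x))\<^sup>2 + (cmod (g x))\<^sup>2)"
    using assms by auto
  show "(\<lambda>x. f x * g x) \<in> borel_measurable period_measure" by measurable
  have "cmod (f x * g x) \<le> (cmod (f x))\<^sup>2 + (cmod (g x))\<^sup>2" for x
    using sum_squares_bound[of "cmod (f x)" "cmod (g x)"] norm_ge_zero[of "f x * g x"]
    unfolding norm_mult by linarith
  then show "AE x in period_measure. norm (f x * g x) \<le> norm ((cmod (f x))\<^sup>2 + (cmod (g x))\<^sup>2)"
    by (intro AE_I2) (metis abs_of_nonneg add_nonneg_nonneg real_norm_def zero_le_power2)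
qed

lemma square_integrable_bounded:
  assumes "f \<in> borel_measurable period_measure" and "\<And>x. x \<in> {0..2*pi} \<Longrightarrow> cmod (f x) \<le> B"
  shows "square_integrable f"
  unfolding square_integrable_def
proof
  show f [measurable]: "f \<in> borel_measurable period_measure" by fact
  show "integrable period_measure (\<lambda>x. (cmod (f x))\<^sup>2)"
  proof (rule period_measure.integrable_const_bound[where B = "B\<^sup>2"])
    show "AE x in period_measure. norm ((cmod (f x))\<^sup>2) \<le> B\<^sup>2"
      using assms(2) by (intro AE_I2) (auto intro!: power_mono)
  qed measurable
qed

lemma square_integrable_continuous:
  assumes "continuous_on {0..2*pi} f"
  shows "square_integrable f"
proof -
  have "bounded (f ` {0..2*pi})"
    by (intro compact_imp_bounded compact_continuous_image assms) simp
  then obtain B where "\<And>x. x \<in> {0..2*pi} \<Longrightarrow> cmod (f x) \<le> B"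
    unfolding bounded_iff by blast
  then show ?thesis
    by (intro square_integrable_bounded continuous_imp_measurable_on_sets_lebesgue assms) auto
qed

lemma square_integrable_cmult:
  assumes "square_integrable f"
  shows "square_integrable (\<lambda>x. c * f x)"
  using assms by (auto simp: square_integrable_def norm_mult power_mult_distrib)

lemma square_integrable_cnj:
  assumes "square_integrable f"
  shows "square_integrable (\<lambda>x. cnj (f x))"
  using assms unfolding square_integrable_def
  by (auto intro!: borel_measurable_continuous_on[where f=cnj] continuous_intros)

lemma square_integrable_add:
  assumes f: "square_integrable f" and g: "square_integrable g"
  shows "square_integrable (\<lambda>x. f x + g x)"
proof -
  have [measurable]: "f \<in> borel_measurable period_measure" "g \<in> borel_measurable period_measure"
    using assms by auto
  have "integrable period_measure (\<lambda>x. (cmod (f x + g x))\<^sup>2)"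
  proof (rule Bochner_Integration.integrable_bound)
    show "integrable period_measure (\<lambda>x. 2 * (cmod (f x))\<^sup>2 + 2 * (cmod (g x))\<^sup>2)"
      using assms by (auto simp: square_integrable_def)
    have "(cmod (f x + g x))\<^sup>2 \<le> 2 * (cmod (f x))\<^sup>2 + 2 * (cmod (g x))\<^sup>2" for x
    proof -
      have "(cmod (f x + g x))\<^sup>2 \<le> (cmod (f x) + cmod (g x))\<^sup>2"
        by (intro power_mono norm_triangle_ineq) auto
      also have "\<dots> \<le> 2 * (cmod (f x))\<^sup>2 + 2 * (cmod (g x))\<^sup>2"
        using sum_squares_bound[of "cmod (f x)" "cmod (g x)"] by (simp add: power2_sum)
      finally show ?thesis .
    qed
    then show "AE x in period_measure. norm ((cmod (f x + g x))\<^sup>2)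
        \<le> norm (2 * (cmod (f x))\<^sup>2 + 2 * (cmod (g x))\<^sup>2)"
      by (intro AE_I2) simp
  qed measurable
  then show ?thesis by (simp add: square_integrable_def)
qed

lemma square_integrable_diff:
  assumes "square_integrable f" "square_integrable g"
  shows "square_integrable (\<lambda>x. f x - g x)"
  using square_integrable_add[OF assms(1) square_integrable_cmult[OF assms(2), of "-1"]] by simp

lemma square_integrable_emode: "square_integrable (emode m)"
  by (intro square_integrable_continuous continuous_emode)

lemma square_integrable_fourier_sum: "square_integrable (fourier_sum c A)"
  unfolding fourier_sum_def
  by (intro square_integrable_continuous continuous_intros continuous_emode)

lemma square_integrable_zero_mean_L2: "zero_mean_L2 f \<Longrightarrow> square_integrable f"
  by (simp add: square_integrable_def zero_mean_L2_def)

lemma integral_derivative_period: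
  fixes f f' :: "real \<Rightarrow> complex"
  assumes "\<And>x. (f has_vector_derivative f' x) (at x)" and "continuous_on {0..2*pi} f'"
  shows "integral\<^sup>L period_measure f' = f (2*pi) - f 0"
proof -
  have "(f' has_integral f (2*pi) - f 0) {0..2*pi}"
    by (rule fundamental_theorem_of_calculus)
       (auto intro: has_vector_derivative_at_within assms)
  moreover have "integral\<^sup>L period_measure f' = integral {0..2*pi} f'"
    by (intro lebesgue_integral_eq_integral continuous_imp_integrable_real assms) simp
  ultimately show ?thesis by (simp add: integral_unique)
qed

lemma integral_emode: "integral\<^sup>L period_measure (emode m) = (if m = 0 then 2 * pi else 0)"
proof (cases "m = 0")
  case True
  then have "integral\<^sup>L period_measure (emode m) = integral\<^sup>L period_measure (\<lambda>x. 1 :: complex)"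
    by (intro Bochner_Integration.integral_cong) auto
  also have "\<dots> = 2 * pi"
    by (simp add: measure_restrict_space scaleR_conv_of_real)
  finally show ?thesis using True by simp
next
  case False
  have "integral\<^sup>L period_measure (\<lambda>x. \<i> * of_int m * emode m x) = emode m (2*pi) - emode m 0"
    by (intro integral_derivative_period has_vector_derivative_emode continuous_intros continuous_emode)
  also have "\<dots> = 0"
    using periodic_emode[of m] by (metis add_0 diff_self periodic_def)
  finally show ?thesis using False by simp
qed

lemma integral_mult_fourier_sum:
  assumes "square_integrable w"
  shows "integral\<^sup>L period_measure (\<lambda>x. w x * fourier_sum c A x) =
    2 * pi * (\<Sum>m\<in>A. c m * fourier_coeff w (- m))"
proof -
  have "integral\<^sup>L period_measure (\<lambda>x. w x * fourier_sum c A x) =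
      integral\<^sup>L period_measure (\<lambda>x. \<Sum>m\<in>A. c m * (w x * emode m x))"
    by (simp add: fourier_sum_def sum_distrib_left mult_ac)
  also have "\<dots> = (\<Sum>m\<in>A. integral\<^sup>L period_measure (\<lambda>x. c m * (w x * emode m x)))"
    by (rule Bochner_Integration.integral_sum)
       (intro integrable_mult_right square_integrable_mult assms square_integrable_emode)
  also have "\<dots> = 2 * pi * (\<Sum>m\<in>A. c m * fourier_coeff w (- m))"
    by (simp add: fourier_coeff_def sum_distrib_left)
  finally show ?thesis .
qed

lemma fourier_coeff_fourier_sum:
  assumes "finite A"
  shows "fourier_coeff (fourier_sum c A) m = (if m \<in> A then c m else 0)"
proof -
  have *: "fourier_coeff (emode n) j = (if n = j then 1 else 0)" for n j
    by (simp add: fourier_coeff_def emode_mult integral_emode)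
  have "integral\<^sup>L period_measure (\<lambda>x. fourier_sum c A x * emode (- m) x) =
      integral\<^sup>L period_measure (\<lambda>x. emode (- m) x * fourier_sum c A x)"
    by (simp add: mult.commute)
  also have "\<dots> = 2 * pi * (\<Sum>n\<in>A. c n * fourier_coeff (emode (- m)) (- n))"
    by (rule integral_mult_fourier_sum[OF square_integrable_emode])
  also have "\<dots> = 2 * pi * (if m \<in> A then c m else 0)"
    using assms by (simp add: * if_distrib cong: if_cong)
  finally show ?thesis by (simp add: fourier_coeff_def)
qed

lemma fourier_coeff_add:
  assumes "square_integrable f" "square_integrable g"
  shows "fourier_coeff (\<lambda>x. f x + g x) m = fourier_coeff f m + fourier_coeff g m"
  using assms
  by (simp add: fourier_coeff_def distrib_right add_divide_distrib square_integrable_mult square_integrable_emode)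

lemma fourier_coeff_cmult: "fourier_coeff (\<lambda>x. c * f x) m = c * fourier_coeff f m"
  by (simp add: fourier_coeff_def mult.assoc)

lemma fourier_coeff_cnj: "fourier_coeff (\<lambda>x. cnj (f x)) m = cnj (fourier_coeff f (- m))"
proof -
  have "integral\<^sup>L period_measure (\<lambda>x. cnj (f x) * emode (- m) x) =
      integral\<^sup>L period_measure (\<lambda>x. cnj (f x * emode m x))"
    by (simp add: cnj_emode)
  also have "\<dots> = cnj (integral\<^sup>L period_measure (\<lambda>x. f x * emode m x))"
    by (rule Bochner_Integration.integral_cnj)
  finally show ?thesis by (simp add: fourier_coeff_def)
qed

lemma integral_norm_fourier_sum:
  assumes "finite A"
  shows "integral\<^sup>L period_measure (\<lambda>x. (cmod (fourier_sum c A x))\<^sup>2) =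
    2 * pi * (\<Sum>m\<in>A. (cmod (c m))\<^sup>2)"
proof -
  have "complex_of_real (integral\<^sup>L period_measure (\<lambda>x. (cmod (fourier_sum c A x))\<^sup>2)) =
     integral\<^sup>L period_measure (\<lambda>x. cnj (fourier_sum c A x) * fourier_sum c A x)"
    by (simp only: integral_complex_of_real[symmetric] complex_norm_square mult.commute)
  also have "\<dots> = 2 * pi * (\<Sum>m\<in>A. c m * cnj (c m))"
    using assms
    by (simp add: integral_mult_fourier_sum square_integrable_cnj square_integrable_fourier_sum
        fourier_coeff_cnj fourier_coeff_fourier_sum)
  also have "\<dots> = complex_of_real (2 * pi * (\<Sum>m\<in>A. (cmod (c m))\<^sup>2))"
    by (simp flip: complex_norm_square)
  finally show ?thesis by (simp only: of_real_eq_iff)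
qed

text \<open>
  Pythagoras: a Fourier sum is the orthogonal projection of \<open>f\<close> onto the span of its modes.  The
  identity is used both for Bessel's inequality and, once the right-hand side is known to tend to
  \<open>0\<close>, for convergence in mean.
\<close>

lemma integral_norm_minus_fourier_sum:
  assumes f: "square_integrable f" and A: "finite A"
  shows "integral\<^sup>L period_measure (\<lambda>x. (cmod (f x - fourier_sum (fourier_coeff f) A x))\<^sup>2) =
    integral\<^sup>L period_measure (\<lambda>x. (cmod (f x))\<^sup>2) - 2 * pi * (\<Sum>m\<in>A. (cmod (fourier_coeff f m))\<^sup>2)"
proof -
  let ?c = "fourier_coeff f" and ?S = "fourier_sum (fourier_coeff f) A"
  have S: "square_integrable ?S" by (rule square_integrable_fourier_sum)
  have int: "integrable period_measure (\<lambda>x. cnj (f x) * ?S x)"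
    by (intro square_integrable_mult square_integrable_cnj f S)
  define R where "R x = Re (cnj (f x) * ?S x)" for x
  have R: "integrable period_measure R"
    unfolding R_def[abs_def] by (rule integrable_Re[OF int])
  have "integral\<^sup>L period_measure (\<lambda>x. cnj (f x) * ?S x) = 2 * pi * (\<Sum>m\<in>A. ?c m * cnj (?c m))"
    by (simp add: integral_mult_fourier_sum square_integrable_cnj f fourier_coeff_cnj)
  also have "\<dots> = complex_of_real (2 * pi * (\<Sum>m\<in>A. (cmod (?c m))\<^sup>2))"
    by (simp flip: complex_norm_square)
  finally have cross: "integral\<^sup>L period_measure R = 2 * pi * (\<Sum>m\<in>A. (cmod (?c m))\<^sup>2)"
    unfolding R_def[abs_def] using int by (simp only: integral_Re Re_complex_of_real)
  have "(cmod (f x - ?S x))\<^sup>2 = (cmod (f x))\<^sup>2 + (cmod (?S x))\<^sup>2 - 2 * R x" for x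
    unfolding R_def cmod_power2 by (simp add: power2_eq_square algebra_simps)
  then show ?thesis
    using square_integrableD(2)[OF f] square_integrableD(2)[OF S] R
    by (simp add: integral_norm_fourier_sum[OF A] cross)
qed

lemma Bessel_inequality:
  assumes "square_integrable f" and "finite A"
  shows "2 * pi * (\<Sum>m\<in>A. (cmod (fourier_coeff f m))\<^sup>2) \<le>
    integral\<^sup>L period_measure (\<lambda>x. (cmod (f x))\<^sup>2)"
proof -
  have "0 \<le> integral\<^sup>L period_measure (\<lambda>x. (cmod (f x - fourier_sum (fourier_coeff f) A x))\<^sup>2)"
    by simp
  then show ?thesis using integral_norm_minus_fourier_sum[OF assms] by simp
qed

lemma Bessel_summable:
  assumes "square_integrable f"
  shows "(\<lambda>m. (cmod (fourier_coeff f m))\<^sup>2) summable_on UNIV"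
proof (rule nonneg_bdd_above_summable_on)
  show "bdd_above (sum (\<lambda>m. (cmod (fourier_coeff f m))\<^sup>2) ` {F. F \<subseteq> UNIV \<and> finite F})"
  proof (rule bdd_aboveI2)
    fix F :: "int set" assume "F \<in> {F. F \<subseteq> UNIV \<and> finite F}"
    then show "(\<Sum>m\<in>F. (cmod (fourier_coeff f m))\<^sup>2) \<le>
        integral\<^sup>L period_measure (\<lambda>x. (cmod (f x))\<^sup>2) / (2 * pi)"
      using Bessel_inequality[OF assms, of F] by (simp add: field_simps)
  qed
qed simp

lemma summable_on_int_imp_LIMSEQ:
  fixes g :: "int \<Rightarrow> real"
  assumes "g summable_on UNIV"
  shows "(\<lambda>n. g (int n)) \<longlonglongrightarrow> 0" "(\<lambda>n. g (- int n - 1)) \<longlonglongrightarrow> 0"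
proof -
  have *: "(\<lambda>n. g (h n)) \<longlonglongrightarrow> 0" if "inj h" for h :: "nat \<Rightarrow> int"
  proof -
    have "g summable_on range h"
      by (rule summable_on_subset_banach[OF assms]) simp
    then have "(g \<circ> h) summable_on UNIV"
      using summable_on_reindex[OF that, of g] by simp
    then have "summable (g \<circ> h)"
      by (auto simp: summable_on_def dest!: has_sum_imp_sums sums_summable)
    then show ?thesis using summable_LIMSEQ_zero by (simp add: o_def)
  qed
  show "(\<lambda>n. g (int n)) \<longlonglongrightarrow> 0" by (rule *) (simp add: inj_on_def)
  show "(\<lambda>n. g (- int n - 1)) \<longlonglongrightarrow> 0" by (rule *) (simp add: inj_on_def)
qed

section \<open>Convergence of Fourier series\<close>

lemma fourier_coeff_mult_emode:
  "fourier_coeff (\<lambda>x. emode n x * f x) m = fourier_coeff f (m - n)"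
proof -
  have "emode n x * f x * emode (- m) x = f x * emode (- (m - n)) x" for x
    using emode_mult[of n x "- m"] by (simp add: mult_ac)
  then show ?thesis by (simp only: fourier_coeff_def)
qed

lemma fourier_coeff_const: "fourier_coeff (\<lambda>x. c) m = (if m = 0 then c else 0)"
  by (simp add: fourier_coeff_def integral_emode)

lemma emode_1_eq_iff:
  assumes "x \<in> {0..2*pi}" "x\<^sub>0 \<in> {0<..<2*pi}"
  shows "emode 1 x = emode 1 x\<^sub>0 \<longleftrightarrow> x = x\<^sub>0"
proof
  assume "emode 1 x = emode 1 x\<^sub>0"
  then have "cis (x - x\<^sub>0) = 1"
    by (simp add: emode_def flip: cis_divide)
  then have "cos (x - x\<^sub>0) = 1"
    by (metis cis.simps(1) one_complex.simps(1))
  then obtain n :: int where n: "x - x\<^sub>0 = of_int n * 2 * pi"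
    unfolding cos_one_2pi_int by blast
  have "\<bar>of_int n * (2 * pi)\<bar> < 1 * (2 * pi)"
    using assms n by auto
  then have "\<bar>real_of_int n\<bar> * (2 * pi) < 1 * (2 * pi)"
    by (simp add: abs_mult)
  then have "\<bar>real_of_int n\<bar> < 1"
    by (rule mult_right_less_imp_less) simp
  then have "n = 0" by linarith
  then show "x = x\<^sub>0" using n by simp
qed simp

text \<open>
  Near \<open>x\<^sub>0\<close> the numerator is at most a multiple of \<open>\<bar>x - x\<^sub>0\<bar>\<close>, and the denominator, whose derivative
  has modulus \<open>1\<close>, is at least half of \<open>\<bar>x - x\<^sub>0\<bar>\<close>; away from \<open>x\<^sub>0\<close> the denominator is bounded below by compactness.  The point \<open>x\<^sub>0\<close> has to be interior because \<open>emode 1\<close>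
  takes the same value at both ends of the period.
\<close>

lemma difference_quotient_bounded:
  assumes bound: "\<And>x. x \<in> {0..2*pi} \<Longrightarrow> cmod (\<phi> x) \<le> B"
    and x\<^sub>0: "x\<^sub>0 \<in> {0<..<2*pi}"
    and deriv: "(\<phi> has_vector_derivative d) (at x\<^sub>0)"
  obtains C where "\<And>x. x \<in> {0..2*pi} \<Longrightarrow>
    cmod ((\<phi> x - \<phi> x\<^sub>0) / (emode 1 x - emode 1 x\<^sub>0)) \<le> C"
proof -
  let ?g = "\<lambda>x. (\<phi> x - \<phi> x\<^sub>0) / (emode 1 x - emode 1 x\<^sub>0)"
  obtain \<delta>\<^sub>1 where \<delta>\<^sub>1: "\<delta>\<^sub>1 > 0" "\<And>x. \<bar>x - x\<^sub>0\<bar> < \<delta>\<^sub>1 \<Longrightarrow>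
      cmod (\<phi> x - \<phi> x\<^sub>0 - (x - x\<^sub>0) *\<^sub>R d) \<le> 1 * \<bar>x - x\<^sub>0\<bar>"
    using deriv unfolding has_vector_derivative_def has_derivative_at_alt
    by (metis real_norm_def zero_less_one)
  obtain \<delta>\<^sub>2 where \<delta>\<^sub>2: "\<delta>\<^sub>2 > 0" "\<And>x. \<bar>x - x\<^sub>0\<bar> < \<delta>\<^sub>2 \<Longrightarrow>
      cmod (emode 1 x - emode 1 x\<^sub>0 - (x - x\<^sub>0) *\<^sub>R (\<i> * of_int 1 * emode 1 x\<^sub>0)) \<le> 1/2 * \<bar>x - x\<^sub>0\<bar>"
    using has_vector_derivative_emode[of 1 x\<^sub>0]
    unfolding has_vector_derivative_def has_derivative_at_alt
    by (metis real_norm_def half_gt_zero zero_less_one)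
  define \<delta> where "\<delta> = min \<delta>\<^sub>1 \<delta>\<^sub>2"
  have near: "cmod (?g x) \<le> 2 * (cmod d + 1)" if "\<bar>x - x\<^sub>0\<bar> < \<delta>" for x
  proof (cases "x = x\<^sub>0")
    case False
    have "cmod (\<phi> x - \<phi> x\<^sub>0) \<le> cmod (\<phi> x - \<phi> x\<^sub>0 - (x - x\<^sub>0) *\<^sub>R d) + cmod ((x - x\<^sub>0) *\<^sub>R d)"
      by (metis diff_add_cancel norm_triangle_ineq)
    also have "\<dots> \<le> (cmod d + 1) * \<bar>x - x\<^sub>0\<bar>"
      using \<delta>\<^sub>1(2)[of x] that by (simp add: \<delta>_def distrib_left mult.commute)
    finally have num: "cmod (\<phi> x - \<phi> x\<^sub>0) \<le> (cmod d + 1) * \<bar>x - x\<^sub>0\<bar>" .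
    have "\<bar>x - x\<^sub>0\<bar> = cmod ((x - x\<^sub>0) *\<^sub>R (\<i> * of_int 1 * emode 1 x\<^sub>0))"
      by (simp add: norm_mult)
    also have "\<dots> \<le> cmod (emode 1 x - emode 1 x\<^sub>0) +
        cmod (emode 1 x - emode 1 x\<^sub>0 - (x - x\<^sub>0) *\<^sub>R (\<i> * of_int 1 * emode 1 x\<^sub>0))"
      by (metis norm_triangle_sub add.commute norm_minus_commute)
    also have "\<dots> \<le> cmod (emode 1 x - emode 1 x\<^sub>0) + 1/2 * \<bar>x - x\<^sub>0\<bar>"
      using \<delta>\<^sub>2(2)[of x] that by (simp add: \<delta>_def)
    finally have den: "1/2 * \<bar>x - x\<^sub>0\<bar> \<le> cmod (emode 1 x - emode 1 x\<^sub>0)" by simp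
    note num
    also have "(cmod d + 1) * \<bar>x - x\<^sub>0\<bar> = 2 * (cmod d + 1) * (1/2 * \<bar>x - x\<^sub>0\<bar>)"
      by (simp add: algebra_simps)
    also have "\<dots> \<le> 2 * (cmod d + 1) * cmod (emode 1 x - emode 1 x\<^sub>0)"
      by (intro mult_left_mono den) simp
    finally show ?thesis
      using den False unfolding norm_divide by (subst pos_divide_le_eq) auto
  qed simp
  define K where "K = {0..2*pi} - ball x\<^sub>0 \<delta>"
  have "compact K" unfolding K_def by (intro compact_diff) auto
  moreover have "continuous_on K (\<lambda>x. cmod (emode 1 x - emode 1 x\<^sub>0))"
    by (intro continuous_intros continuous_emode)
  moreover have pos: "cmod (emode 1 x - emode 1 x\<^sub>0) > 0" if "x \<in> K" for x
    using that emode_1_eq_iff[of x x\<^sub>0] x\<^sub>0 \<delta>\<^sub>1(1) \<delta>\<^sub>2(1) by (auto simp: K_def \<delta>_def)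
  ultimately obtain c where c: "c > 0" "\<And>x. x \<in> K \<Longrightarrow> c \<le> cmod (emode 1 x - emode 1 x\<^sub>0)"
  proof (cases "K = {}")
    case False
    with \<open>compact K\<close> \<open>continuous_on K _\<close> obtain y where
      "y \<in> K" "\<And>x. x \<in> K \<Longrightarrow> cmod (emode 1 y - emode 1 x\<^sub>0) \<le> cmod (emode 1 x - emode 1 x\<^sub>0)"
      using continuous_attains_inf[of K "\<lambda>x. cmod (emode 1 x - emode 1 x\<^sub>0)"] by blast
    then show ?thesis using pos that by blast
  qed (use that[of 1] in auto)
  have far: "cmod (?g x) \<le> 2 * B / c" if "x \<in> K" for x
  proof -
    have "cmod (\<phi> x - \<phi> x\<^sub>0) \<le> 2 * B"
      using norm_triangle_ineq4[of "\<phi> x" "\<phi> x\<^sub>0"] bound[of x] bound[of x\<^sub>0] that x\<^sub>0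
      by (auto simp: K_def)
    moreover from this have "0 \<le> 2 * B"
      using norm_ge_zero order_trans by blast
    ultimately show ?thesis
      unfolding norm_divide using c that by (intro frac_le) auto
  qed
  have "cmod (?g x) \<le> max (2 * (cmod d + 1)) (2 * B / c)" if "x \<in> {0..2*pi}" for x
    using near[of x] far[of x] that
    by (cases "x \<in> K") (auto simp: K_def dist_real_def abs_minus_commute le_max_iff_disj)
  then show ?thesis by (rule that)
qed

lemma sum_int_telescope:
  fixes h :: "int \<Rightarrow> 'a::ab_group_add"
  shows "(\<Sum>m\<in>{- int N..int N}. h (m - 1) - h m) = h (- int N - 1) - h (int N)"
proof (induction N)
  case (Suc N)
  have "{- int (Suc N)..int (Suc N)} = insert (- int N - 1) (insert (int N + 1) {- int N..int N})"
    by auto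
  then show ?case using Suc.IH by (simp add: algebra_simps)
qed simp

text \<open>
  The difference quotient \<open>g\<close> of \<open>\<phi>\<close> against \<open>emode 1\<close> satisfies
  \<open>\<phi> = \<phi> x\<^sub>0 + (emode 1 - emode 1 x\<^sub>0) * g\<close>.  On the Fourier side multiplication by
  \<open>emode 1 - emode 1 x\<^sub>0\<close> is a difference operator, so at \<open>x\<^sub>0\<close> the symmetric partial sums telescope
  to \<open>\<phi> x\<^sub>0\<close> plus two boundary terms of modulus \<open>\<bar>fourier_coeff g m\<bar>\<close>.  These vanish in the limit by
  Bessel's inequality for the bounded function \<open>g\<close>.
\<close>

lemma fourier_series_at_differentiable_point:
  assumes meas: "\<phi> \<in> borel_measurable period_measure"
    and bound: "\<And>x. x \<in> {0..2*pi} \<Longrightarrow> cmod (\<phi> x) \<le> B"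
    and x\<^sub>0: "x\<^sub>0 \<in> {0<..<2*pi}"
    and deriv: "(\<phi> has_vector_derivative d) (at x\<^sub>0)"
  shows "(\<lambda>N. fourier_sum (fourier_coeff \<phi>) {- int N..int N} x\<^sub>0) \<longlonglongrightarrow> \<phi> x\<^sub>0"
proof -
  define g where "g x = (\<phi> x - \<phi> x\<^sub>0) / (emode 1 x - emode 1 x\<^sub>0)" for x
  have em: "emode 1 \<in> borel_measurable period_measure"
    using square_integrable_emode by auto
  obtain C where "\<And>x. x \<in> {0..2*pi} \<Longrightarrow> cmod (g x) \<le> C"
    using difference_quotient_bounded[OF bound x\<^sub>0 deriv] unfolding g_def by blast
  moreover have "g \<in> borel_measurable period_measure"
    unfolding g_def[abs_def] by (intro borel_measurable_divide borel_measurable_diff meas em) auto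
  ultimately have g: "square_integrable g" by (rule square_integrable_bounded[rotated])
  have \<phi>: "\<phi> x = \<phi> x\<^sub>0 + (emode 1 x * g x + (- emode 1 x\<^sub>0) * g x)" if "x \<in> {0..2*pi}" for x
  proof -
    have "(emode 1 x - emode 1 x\<^sub>0) * g x = \<phi> x - \<phi> x\<^sub>0"
      using emode_1_eq_iff[OF that x\<^sub>0] by (cases "x = x\<^sub>0") (simp_all add: g_def)
    then show ?thesis by (simp add: left_diff_distrib)
  qed
  have g1: "square_integrable (\<lambda>x. emode 1 x * g x)"
  proof (rule square_integrable_bounded)
    show "(\<lambda>x. emode 1 x * g x) \<in> borel_measurable period_measure"
      using g by (intro borel_measurable_times em) auto
    show "cmod (emode 1 x * g x) \<le> C" if "x \<in> {0..2*pi}" for x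
      using \<open>\<And>x. x \<in> {0..2*pi} \<Longrightarrow> cmod (g x) \<le> C\<close>[OF that] by (simp add: norm_mult)
  qed
  have "fourier_coeff \<phi> m =
      fourier_coeff (\<lambda>x. \<phi> x\<^sub>0 + (emode 1 x * g x + (- emode 1 x\<^sub>0) * g x)) m" for m
    unfolding fourier_coeff_def
    by (intro arg_cong2[where f = "(/)"] refl Bochner_Integration.integral_cong
        arg_cong2[where f = "(*)"] \<phi>) simp
  also have "\<dots> m = fourier_coeff (\<lambda>x. \<phi> x\<^sub>0) m +
      (fourier_coeff (\<lambda>x. emode 1 x * g x) m + fourier_coeff (\<lambda>x. (- emode 1 x\<^sub>0) * g x) m)" for m
    using g1 square_integrable_cmult[OF g] square_integrable_continuous[OF continuous_on_const]
    by (simp only: fourier_coeff_add square_integrable_add)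
  also have "\<dots> m = (if m = 0 then \<phi> x\<^sub>0 else 0) +
      (fourier_coeff g (m - 1) - emode 1 x\<^sub>0 * fourier_coeff g m)" for m
    by (simp only: fourier_coeff_const fourier_coeff_cmult fourier_coeff_mult_emode) simp
  finally have coeff: "fourier_coeff \<phi> m = (if m = 0 then \<phi> x\<^sub>0 else 0) +
      (fourier_coeff g (m - 1) - emode 1 x\<^sub>0 * fourier_coeff g m)" for m .
  define h where "h m = fourier_coeff g m * emode (m + 1) x\<^sub>0" for m
  have summand: "fourier_coeff \<phi> m * emode m x\<^sub>0 = (if m = 0 then \<phi> x\<^sub>0 else 0) + (h (m - 1) - h m)" for m
    unfolding coeff h_def using emode_mult[of 1 x\<^sub>0 m] by (auto simp: algebra_simps)
  have sum: "fourier_sum (fourier_coeff \<phi>) {- int N..int N} x\<^sub>0 = \<phi> x\<^sub>0 + (h (- int N - 1) - h (int N))" for N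
    unfolding fourier_sum_def summand by (simp add: sum.distrib sum_int_telescope)
  have zero: "(\<lambda>n. h (k n)) \<longlonglongrightarrow> 0"
    if "(\<lambda>n. (cmod (fourier_coeff g (k n)))\<^sup>2) \<longlonglongrightarrow> 0" for k :: "nat \<Rightarrow> int"
  proof (rule tendsto_norm_zero_cancel)
    have "(\<lambda>n. cmod (fourier_coeff g (k n))) \<longlonglongrightarrow> 0"
      using tendsto_real_sqrt[OF that] by simp
    then show "(\<lambda>n. cmod (h (k n))) \<longlonglongrightarrow> 0"
      by (simp add: h_def norm_mult)
  qed
  have "(\<lambda>N. \<phi> x\<^sub>0 + (h (- int N - 1) - h (int N))) \<longlonglongrightarrow> \<phi> x\<^sub>0 + (0 - 0)"
    by (intro tendsto_intros zero summable_on_int_imp_LIMSEQ[OF Bessel_summable[OF g]])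
  then show ?thesis by (simp add: sum)
qed

text \<open>
  By Fatou's lemma, pointwise convergence almost everywhere bounds the energy of \<open>\<phi>\<close> by the limit of
  the energies of its partial sums, and Bessel's inequality is the opposite bound.  Hence Parseval's
  identity holds for \<open>\<phi>\<close>, and the projection identity turns it into convergence in mean.
\<close>

lemma fourier_series_converges_in_mean:
  assumes \<phi>: "square_integrable \<phi>"
    and conv: "AE x in period_measure.
      (\<lambda>N. fourier_sum (fourier_coeff \<phi>) {- int N..int N} x) \<longlonglongrightarrow> \<phi> x"
  shows "(\<lambda>N. integral\<^sup>L period_measure
    (\<lambda>x. (cmod (\<phi> x - fourier_sum (fourier_coeff \<phi>) {- int N..int N} x))\<^sup>2)) \<longlonglongrightarrow> 0"
proof -
  let ?S = "\<lambda>N. fourier_sum (fourier_coeff \<phi>) {- int N..int N}"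
  define I where "I = integral\<^sup>L period_measure (\<lambda>x. (cmod (\<phi> x))\<^sup>2)"
  define a where "a N = 2 * pi * (\<Sum>m\<in>{- int N..int N}. (cmod (fourier_coeff \<phi> m))\<^sup>2)" for N
  have S [measurable]: "?S N \<in> borel_measurable period_measure" for N
    using square_integrable_fourier_sum by auto
  have "incseq a"
    unfolding a_def by (intro incseq_SucI mult_left_mono sum_mono2) auto
  moreover have "a N \<le> I" for N
    unfolding a_def I_def by (rule Bessel_inequality[OF \<phi>]) simp
  ultimately obtain l where l: "a \<longlonglongrightarrow> l" "\<And>N. a N \<le> l"
    using incseq_convergent[of a I] by blast
  have "l \<le> I"
    using LIMSEQ_le_const2[OF l(1)] \<open>\<And>N. a N \<le> I\<close> by blast
  have nn: "(\<integral>\<^sup>+x. ennreal ((cmod (?S N x))\<^sup>2) \<partial>period_measure) = ennreal (a N)" for N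
    using square_integrable_fourier_sum[of "fourier_coeff \<phi>" "{- int N..int N}"]
    by (subst nn_integral_eq_integral) (auto simp: integral_norm_fourier_sum a_def)
  have "ennreal I = (\<integral>\<^sup>+x. ennreal ((cmod (\<phi> x))\<^sup>2) \<partial>period_measure)"
    using \<phi> by (subst nn_integral_eq_integral) (auto simp: I_def)
  also have "\<dots> = (\<integral>\<^sup>+x. liminf (\<lambda>N. ennreal ((cmod (?S N x))\<^sup>2)) \<partial>period_measure)"
  proof (rule nn_integral_cong_AE, use conv in eventually_elim)
    case (elim x)
    then have "(\<lambda>N. ennreal ((cmod (?S N x))\<^sup>2)) \<longlonglongrightarrow> ennreal ((cmod (\<phi> x))\<^sup>2)"
      by (intro tendsto_intros)
    then show ?case by (intro lim_imp_Liminf[symmetric] trivial_limit_sequentially)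
  qed
  also have "\<dots> \<le> liminf (\<lambda>N. ennreal (a N))"
    unfolding nn[symmetric] by (rule nn_integral_liminf) measurable
  also have "\<dots> = ennreal l"
    using l(1) by (intro lim_imp_Liminf tendsto_intros) auto
  finally have "I \<le> l"
    using l(2)[of 0] by (subst (asm) ennreal_le_iff) (auto simp: a_def intro: order_trans[rotated] sum_nonneg)
  with \<open>l \<le> I\<close> l(1) have "a \<longlonglongrightarrow> I" by simp
  then have "(\<lambda>N. I - a N) \<longlonglongrightarrow> I - I" by (intro tendsto_intros)
  then show ?thesis
    by (simp add: integral_norm_minus_fourier_sum[OF \<phi>] I_def a_def)
qed

text \<open>
  A bilinear Parseval identity in which only \<open>\<phi>\<close> has to be regular; \<open>w\<close> is an arbitrary element of
  \<open>L\<^sup>2\<close>.  It is applied to step functions, to get uniqueness of Fourier coefficients, and to smooth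
  test functions, to get weak derivatives.
\<close>

lemma integral_mult_fourier_series:
  assumes w: "square_integrable w" and \<phi>: "square_integrable \<phi>"
    and conv: "AE x in period_measure.
      (\<lambda>N. fourier_sum (fourier_coeff \<phi>) {- int N..int N} x) \<longlonglongrightarrow> \<phi> x"
  shows "(\<lambda>N. 2 * pi * (\<Sum>m\<in>{- int N..int N}. fourier_coeff \<phi> m * fourier_coeff w (- m)))
    \<longlonglongrightarrow> integral\<^sup>L period_measure (\<lambda>x. w x * \<phi> x)"
proof (rule LIMSEQ_I)
  fix e :: real assume "e > 0"
  let ?S = "\<lambda>N. fourier_sum (fourier_coeff \<phi>) {- int N..int N}"
  define D where "D N = integral\<^sup>L period_measure (\<lambda>x. (cmod (\<phi> x - ?S N x))\<^sup>2)" for N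
  define W where "W = integral\<^sup>L period_measure (\<lambda>x. (cmod (w x))\<^sup>2)"
  have "W \<ge> 0" unfolding W_def by simp
  \<comment> \<open>The weight in \<open>2 * a * b \<le> \<eta> * a\<^sup>2 + b\<^sup>2 / \<eta>\<close>, chosen so that the \<open>w\<close> part costs less than \<open>e / 2\<close>.\<close>
  define \<eta> where "\<eta> = e / (2 * (W + 1))"
  have "\<eta> > 0" unfolding \<eta>_def using \<open>e > 0\<close> \<open>W \<ge> 0\<close> by simp
  have "\<eta> * W < e / 2"
    unfolding \<eta>_def using \<open>e > 0\<close> \<open>W \<ge> 0\<close> by (simp add: field_simps)
  have "D \<longlonglongrightarrow> 0"
    unfolding D_def by (rule fourier_series_converges_in_mean[OF \<phi> conv])
  then obtain M where M: "\<And>N. N \<ge> M \<Longrightarrow> D N < \<eta> * (e / 2)"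
    using order_tendstoD(2)[of D 0 sequentially "\<eta> * (e / 2)"] \<open>\<eta> > 0\<close> \<open>e > 0\<close>
    unfolding eventually_sequentially by fastforce
  show "\<exists>M. \<forall>N\<ge>M. norm (2 * pi * (\<Sum>m\<in>{- int N..int N}. fourier_coeff \<phi> m * fourier_coeff w (- m))
      - integral\<^sup>L period_measure (\<lambda>x. w x * \<phi> x)) < e"
  proof (intro exI allI impI)
    fix N assume "N \<ge> M"
    have d: "square_integrable (\<lambda>x. \<phi> x - ?S N x)"
      by (intro square_integrable_diff \<phi> square_integrable_fourier_sum)
    have "2 * pi * (\<Sum>m\<in>{- int N..int N}. fourier_coeff \<phi> m * fourier_coeff w (- m))
        - integral\<^sup>L period_measure (\<lambda>x. w x * \<phi> x) =
        - integral\<^sup>L period_measure (\<lambda>x. w x * (\<phi> x - ?S N x))"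
      using square_integrable_mult[OF w \<phi>] square_integrable_mult[OF w square_integrable_fourier_sum]
      by (simp add: right_diff_distrib integral_mult_fourier_sum[OF w])
    also have "norm \<dots> \<le> integral\<^sup>L period_measure (\<lambda>x. cmod (w x * (\<phi> x - ?S N x)))"
      unfolding norm_minus_cancel by (rule integral_norm_bound)
    also have "\<dots> \<le> integral\<^sup>L period_measure
        (\<lambda>x. \<eta> * (cmod (w x))\<^sup>2 + (cmod (\<phi> x - ?S N x))\<^sup>2 / \<eta>)"
    proof (rule integral_mono)
      show "integrable period_measure (\<lambda>x. cmod (w x * (\<phi> x - ?S N x)))"
        by (intro integrable_norm square_integrable_mult w d)
      show "integrable period_measure (\<lambda>x. \<eta> * (cmod (w x))\<^sup>2 + (cmod (\<phi> x - ?S N x))\<^sup>2 / \<eta>)"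
        using w d by (auto simp: square_integrable_def)
      fix x
      have "2 * (\<eta> * cmod (w x)) * cmod (\<phi> x - ?S N x) \<le>
          (\<eta> * cmod (w x))\<^sup>2 + (cmod (\<phi> x - ?S N x))\<^sup>2"
        by (rule sum_squares_bound)
      moreover have "0 \<le> \<eta> * cmod (w x) * cmod (\<phi> x - ?S N x)"
        using \<open>\<eta> > 0\<close> by simp
      moreover have "\<eta> * (\<eta> * (cmod (w x))\<^sup>2 + (cmod (\<phi> x - ?S N x))\<^sup>2 / \<eta>) =
          (\<eta> * cmod (w x))\<^sup>2 + (cmod (\<phi> x - ?S N x))\<^sup>2"
        using \<open>\<eta> > 0\<close> by (simp add: power2_eq_square distrib_left)
      ultimately have "\<eta> * (cmod (w x) * cmod (\<phi> x - ?S N x)) \<le>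
          \<eta> * (\<eta> * (cmod (w x))\<^sup>2 + (cmod (\<phi> x - ?S N x))\<^sup>2 / \<eta>)"
        unfolding mult.assoc by linarith
      then show "cmod (w x * (\<phi> x - ?S N x)) \<le> \<eta> * (cmod (w x))\<^sup>2 + (cmod (\<phi> x - ?S N x))\<^sup>2 / \<eta>"
        using \<open>\<eta> > 0\<close> by (simp add: norm_mult)
    qed
    also have "\<dots> = \<eta> * W + D N / \<eta>"
      using square_integrableD(2)[OF w] square_integrableD(2)[OF d] by (simp add: W_def D_def)
    also have "D N / \<eta> < e / 2"
      using M[OF \<open>N \<ge> M\<close>] \<open>\<eta> > 0\<close> by (simp add: field_simps)
    finally show "norm (2 * pi * (\<Sum>m\<in>{- int N..int N}. fourier_coeff \<phi> m * fourier_coeff w (- m))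
      - integral\<^sup>L period_measure (\<lambda>x. w x * \<phi> x)) < e"
      using \<open>\<eta> * W < e / 2\<close> by simp
  qed
qed

lemma AE_period_not_in_finite:
  assumes "finite F"
  shows "AE x in period_measure. x \<notin> F"
proof -
  have "F \<in> null_sets lebesgue"
    using negligible_finite[OF assms] by (simp add: negligible_iff_null_sets)
  then have "AE x in lebesgue. x \<notin> F" by (rule AE_not_in)
  then show ?thesis by (auto simp: AE_restrict_space_iff elim: eventually_mono)
qed

text \<open>
  The indicator of an interval is differentiable off its end points, so its Fourier series converges
  almost everywhere and the integral of \<open>w\<close> over the interval is a limit of combinations of Fourier
  coefficients of \<open>w\<close>, all zero.  A function whose integral over every interval vanishes is zero
  almost everywhere by Lebesgue differentiation.
\<close>

lemma fourier_coeff_zero_imp_AE_zero: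
  assumes w: "square_integrable w" and zero: "\<And>m. fourier_coeff w m = 0"
  shows "AE x in period_measure. w x = 0"
proof -
  define f where "f x = (if x \<in> {0..2*pi} then w x else 0)" for x
  have w_int: "integrable period_measure w"
    using square_integrable_mult[OF w square_integrable_emode[of 0]] by simp
  have f_int: "integrable lebesgue f"
    unfolding f_def[abs_def] by (rule iffD2[OF Lebesgue_Measure.integrable_restrict_UNIV w_int]) simp
  have "f absolutely_integrable_on UNIV"
    using f_int by (simp add: set_integrable_def)
  then have abs: "f absolutely_integrable_on {a..b}" for a b
    by (rule set_integrable_subset) auto
  have interval: "integral {a..b} f = 0" for a b
  proof -
    let ?\<phi> = "indicator {a..b} :: real \<Rightarrow> complex"
    have meas: "?\<phi> \<in> borel_measurable period_measure"
      by (intro measurable_restrict_space1 borel_measurable_indicator) simp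
    have bd: "cmod (?\<phi> x) \<le> 1" for x by (auto simp: indicator_def)
    have "AE x in period_measure. x \<in> {0..2*pi}" by (rule AE_I2) simp
    moreover have "AE x in period_measure. x \<notin> {0, 2*pi, a, b}"
      by (rule AE_period_not_in_finite) simp
    ultimately have "AE x in period_measure.
        (\<lambda>N. fourier_sum (fourier_coeff ?\<phi>) {- int N..int N} x) \<longlonglongrightarrow> ?\<phi> x"
    proof eventually_elim
      case (elim x)
      have "(?\<phi> has_vector_derivative 0) (at x)"
      proof (rule has_vector_derivative_transform_within_open[where f = "\<lambda>_. ?\<phi> x"])
        show "open (if x \<in> {a..b} then {a<..<b} else - {a..b})" by auto
      qed (use elim in \<open>auto simp: indicator_def split: if_splits\<close>)
      then show ?case
        using elim by (intro fourier_series_at_differentiable_point[OF meas bd]) auto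
    qed
    from integral_mult_fourier_series[OF w square_integrable_bounded[OF meas bd] this]
    have "integral\<^sup>L period_measure (\<lambda>x. w x * ?\<phi> x) = 0"
      using zero by (simp add: LIMSEQ_const_iff)
    also have "integral\<^sup>L period_measure (\<lambda>x. w x * ?\<phi> x) =
        integral\<^sup>L lebesgue (\<lambda>x. indicator {a..b} x *\<^sub>R f x)"
      by (subst integral_restrict_space)
         (auto intro!: Bochner_Integration.integral_cong simp: f_def indicator_def)
    also have "\<dots> = integral {a..b} f"
      using set_lebesgue_integral_eq_integral(2)[OF abs] by (simp add: set_lebesgue_integral_def)
    finally show ?thesis .
  qed
  have f_on: "f integrable_on cbox a b" for a b
    using set_lebesgue_integral_eq_integral(1)[OF abs] by simp
  obtain N where N: "negligible N" "\<And>x e. \<lbrakk>x \<notin> N; 0 < e\<rbrakk> \<Longrightarrow>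
      \<exists>d>0. \<forall>h. 0 < h \<and> h < d \<longrightarrow> norm (integral (cbox x (x + h *\<^sub>R One)) f /\<^sub>R h ^ DIM(real) - f x) < e"
    using integrable_ccontinuous_explicit[of f, OF f_on] by metis
  have "f x = 0" if xN: "x \<notin> N" for x
  proof (rule ccontr)
    assume "f x \<noteq> 0"
    then obtain d where d: "d > 0" "\<And>h. 0 < h \<Longrightarrow> h < d \<Longrightarrow>
        norm (integral (cbox x (x + h *\<^sub>R One)) f /\<^sub>R h ^ DIM(real) - f x) < norm (f x)"
      using N(2)[OF xN, of "norm (f x)"] by auto
    show False using d(2)[of "d/2"] d(1) interval by simp
  qed
  moreover have "AE x in lebesgue. x \<notin> N"
    using N(1) by (intro AE_not_in) (simp add: negligible_iff_null_sets)
  ultimately have "AE x in lebesgue. f x = 0" by (auto elim: eventually_mono)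
  then show ?thesis by (auto simp: AE_restrict_space_iff f_def elim: eventually_mono)
qed

section \<open>Fourier series of smooth periodic functions\<close>

lemma iter_deriv_Suc: "iter_deriv (Suc n) f x = vector_derivative (iter_deriv n f) (at x)"
  by (simp add: iter_deriv_def)

lemma smooth_has_vector_derivative:
  assumes "smooth \<phi>"
  shows "(iter_deriv n \<phi> has_vector_derivative iter_deriv (Suc n) \<phi> x) (at x)"
  using assms by (simp add: smooth_def iter_deriv_Suc flip: vector_derivative_works)

lemma smooth_continuous:
  assumes "smooth \<phi>"
  shows "continuous_on S (iter_deriv n \<phi>)"
  using has_vector_derivative_continuous[OF smooth_has_vector_derivative[OF assms]]
  by (intro continuous_at_imp_continuous_on) blast

lemma iter_deriv_emode: "iter_deriv n (emode m) = (\<lambda>x. (\<i> * of_int m) ^ n * emode m x)"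
proof (induction n)
  case (Suc n)
  have "((\<lambda>x. (\<i> * of_int m) ^ n * emode m x) has_vector_derivative
      (\<i> * of_int m) ^ n * (\<i> * of_int m * emode m x)) (at x)" for x
    by (intro has_vector_derivative_mult_right has_vector_derivative_emode)
  from vector_derivative_at[OF this] show ?case
    by (simp add: fun_eq_iff iter_deriv_Suc Suc.IH mult_ac)
qed (simp add: iter_deriv_def)

lemma smooth_emode: "smooth (emode m)"
  unfolding smooth_def iter_deriv_emode
  by (auto intro!: differentiableI_vector has_vector_derivative_mult_right has_vector_derivative_emode)

lemma periodic_iter_deriv:
  assumes "smooth \<phi>" "periodic \<phi>"
  shows "periodic (iter_deriv n \<phi>)"
proof (induction n)
  case 0
  then show ?case using assms by (simp add: iter_deriv_def)
next
  case (Suc n)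
  have "iter_deriv (Suc n) \<phi> (x + 2*pi) = iter_deriv (Suc n) \<phi> x" for x
  proof -
    have "((\<lambda>x. x + 2*pi) has_vector_derivative 1) (at x)"
      by (auto intro!: derivative_eq_intros)
    from vector_diff_chain_at[OF this smooth_has_vector_derivative[OF assms(1), of n]]
    have "(iter_deriv n \<phi> has_vector_derivative iter_deriv (Suc n) \<phi> (x + 2*pi)) (at x)"
      using Suc.IH by (simp add: o_def periodic_def)
    then show ?thesis by (simp add: iter_deriv_Suc vector_derivative_at)
  qed
  then show ?case by (simp add: periodic_def)
qed

lemma fourier_coeff_deriv:
  assumes deriv: "\<And>x. (\<phi> has_vector_derivative \<phi>' x) (at x)"
    and cont: "continuous_on {0..2*pi} \<phi>'" and per: "periodic \<phi>"
  shows "fourier_coeff \<phi>' m = \<i> * of_int m * fourier_coeff \<phi> m"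
proof -
  have c: "continuous_on {0..2*pi} \<phi>"
    using has_vector_derivative_continuous[OF deriv] by (intro continuous_at_imp_continuous_on) blast
  have int: "integrable period_measure (\<lambda>x. \<phi>' x * emode (- m) x)"
    "integrable period_measure (\<lambda>x. \<phi> x * emode (- m) x)"
    by (intro square_integrable_mult square_integrable_continuous cont c square_integrable_emode)+
  have "integral\<^sup>L period_measure (\<lambda>x. \<phi> x * (\<i> * of_int (- m) * emode (- m) x) + \<phi>' x * emode (- m) x) =
      \<phi> (2*pi) * emode (- m) (2*pi) - \<phi> 0 * emode (- m) 0"
    by (intro integral_derivative_period has_vector_derivative_mult deriv has_vector_derivative_emode
        continuous_intros continuous_emode cont c)
  also have "\<dots> = 0"
    using per periodic_emode[of "- m"] by (metis add_0 diff_self periodic_def)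
  also have "(\<lambda>x. \<phi> x * (\<i> * of_int (- m) * emode (- m) x) + \<phi>' x * emode (- m) x) =
      (\<lambda>x. \<phi>' x * emode (- m) x - \<i> * of_int m * (\<phi> x * emode (- m) x))"
    by (simp add: fun_eq_iff)
  finally show ?thesis
    using int by (simp add: fourier_coeff_def)
qed

lemma fourier_coeff_iter_deriv:
  assumes "smooth \<phi>" "periodic \<phi>"
  shows "fourier_coeff (iter_deriv n \<phi>) m = (\<i> * of_int m) ^ n * fourier_coeff \<phi> m"
proof (induction n)
  case (Suc n)
  have "fourier_coeff (iter_deriv (Suc n) \<phi>) m = \<i> * of_int m * fourier_coeff (iter_deriv n \<phi>) m"
    by (intro fourier_coeff_deriv smooth_has_vector_derivative smooth_continuous
        periodic_iter_deriv assms)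
  then show ?case by (simp add: Suc.IH)
qed (simp add: iter_deriv_def)

text \<open>
  Testing against derivatives of a smooth function only multiplies its Fourier coefficients by powers
  of \<open>\<i> * m\<close>, so both sides of the definition of a weak derivative become limits of sums over modes.
\<close>

lemma integral_mult_smooth:
  assumes w: "square_integrable w" and \<phi>: "smooth \<phi>" "periodic \<phi>"
  shows "(\<lambda>N. 2 * pi * (\<Sum>m\<in>{- int N..int N}.
      (\<i> * of_int m) ^ n * fourier_coeff \<phi> m * fourier_coeff w (- m)))
    \<longlonglongrightarrow> integral\<^sup>L period_measure (\<lambda>x. w x * iter_deriv n \<phi> x)"
proof -
  let ?\<psi> = "iter_deriv n \<phi>"
  have "bounded (?\<psi> ` {0..2*pi})"
    by (intro compact_imp_bounded compact_continuous_image smooth_continuous \<phi>) simp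
  then obtain B where B: "\<And>x. x \<in> {0..2*pi} \<Longrightarrow> cmod (?\<psi> x) \<le> B"
    unfolding bounded_iff by blast
  have meas: "?\<psi> \<in> borel_measurable period_measure"
    by (rule smooth_iter_deriv_measurable[OF \<phi>(1)])
  have "AE x in period_measure. x \<in> {0..2*pi}" by (rule AE_I2) simp
  moreover have "AE x in period_measure. x \<notin> {0, 2*pi}"
    by (rule AE_period_not_in_finite) simp
  ultimately have "AE x in period_measure.
      (\<lambda>N. fourier_sum (fourier_coeff ?\<psi>) {- int N..int N} x) \<longlonglongrightarrow> ?\<psi> x"
  proof eventually_elim
    case (elim x)
    then show ?case
      by (intro fourier_series_at_differentiable_point[OF meas B _ smooth_has_vector_derivative[OF \<phi>(1)]])
         auto
  qed
  from integral_mult_fourier_series[OF w square_integrable_bounded[OF meas B] this]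
  show ?thesis by (simp add: fourier_coeff_iter_deriv \<phi>)
qed

section \<open>Fourier coefficients of elements of the Hilbert space\<close>

lift_definition L2per_coeff :: "L2per \<Rightarrow> int \<Rightarrow> complex" is fourier_coeff
proof
  fix f g m assume *: "L2_eq f g"
  then have meas: "f \<in> borel_measurable period_measure" "g \<in> borel_measurable period_measure"
    "emode (- m) \<in> borel_measurable period_measure"
    using square_integrable_emode by (auto simp: L2_eq_def zero_mean_L2_def)
  then show "fourier_coeff f m = fourier_coeff g m"
    unfolding fourier_coeff_def using * meas
    by (intro arg_cong2[where f = "(/)"] refl integral_cong_AE borel_measurable_times)
       (auto simp: L2_eq_def elim: eventually_mono)
qed

lemma L2per_coeff_zero_mode [simp]: "L2per_coeff u 0 = 0"
  by transfer (simp add: L2_eq_def zero_mean_L2_def fourier_coeff_def)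

lemma L2per_coeff_add [simp]: "L2per_coeff (u + v) m = L2per_coeff u m + L2per_coeff v m"
  by transfer (simp add: L2_eq_def fourier_coeff_add square_integrable_zero_mean_L2)

lemma L2per_coeff_scaleC [simp]: "L2per_coeff (z *\<^sub>C u) m = z * L2per_coeff u m"
  by transfer (rule fourier_coeff_cmult)

lemma L2per_coeff_scaleR [simp]: "L2per_coeff (r *\<^sub>R u) m = of_real r * L2per_coeff u m"
  by (simp add: scaleR_L2per_def)

lemma L2per_coeff_minus [simp]: "L2per_coeff (- u) m = - L2per_coeff u m"
  by (simp add: uminus_L2per_def)

lemma L2per_coeff_diff [simp]: "L2per_coeff (u - v) m = L2per_coeff u m - L2per_coeff v m"
  unfolding minus_L2per_def L2per_coeff_add L2per_coeff_minus by simp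

lemma L2per_coeff_zero [simp]: "L2per_coeff 0 m = 0"
  using L2per_coeff_diff[of 0 0 m] by simp

lemma L2per_coeff_sum: "L2per_coeff (sum f A) m = (\<Sum>k\<in>A. L2per_coeff (f k) m)"
  by (induction A rule: infinite_finite_induct) auto

lemma L2per_eqI:
  assumes "\<And>m. L2per_coeff u m = L2per_coeff v m"
  shows "u = v"
proof -
  have "w = 0" if "\<forall>m. L2per_coeff w m = 0" for w
    using that
  proof transfer
    fix f assume f: "L2_eq f f" and zero: "\<forall>m. fourier_coeff f m = 0"
    then have "square_integrable f"
      by (auto simp: L2_eq_def square_integrable_zero_mean_L2)
    then show "L2_eq f (\<lambda>x. 0)"
      using fourier_coeff_zero_imp_AE_zero[of f] f zero
      by (simp add: L2_eq_def zero_mean_L2_zero)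
  qed
  from this[of "u - v"] show ?thesis using assms by simp
qed

lemma inner_L2per_self:
  "Re (integral\<^sup>L period_measure (\<lambda>x. f x * cnj (f x))) =
    integral\<^sup>L period_measure (\<lambda>x. (cmod (f x))\<^sup>2)"
  by (simp only: complex_norm_square[symmetric] integral_complex_of_real Re_complex_of_real)

lemma L2per_Bessel:
  assumes "finite A"
  shows "2 * pi * (\<Sum>m\<in>A. (cmod (L2per_coeff u m))\<^sup>2) \<le> (norm u)\<^sup>2"
  unfolding power2_norm_eq_inner[of u] using assms
  by transfer (simp add: inner_L2per_self L2_eq_def Bessel_inequality square_integrable_zero_mean_L2)

lemma L2per_coeff_square_summable: "(\<lambda>m. (cmod (L2per_coeff u m))\<^sup>2) summable_on UNIV"
  by transfer (simp add: L2_eq_def Bessel_summable square_integrable_zero_mean_L2)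

text \<open>
  Absolute summability makes the Fourier series converge uniformly, to a continuous function with the
  prescribed coefficients.  The norm bound is one half of Parseval's identity; the other half is
  Bessel's inequality.
\<close>

lemma absolutely_summable_fourier_series:
  assumes c: "(\<lambda>m. cmod (c m)) summable_on UNIV" and "c 0 = 0"
  obtains u where "\<And>m. L2per_coeff u m = c m"
    and "\<And>B. (\<And>A. finite A \<Longrightarrow> 2 * pi * (\<Sum>m\<in>A. (cmod (c m))\<^sup>2) \<le> B) \<Longrightarrow> (norm u)\<^sup>2 \<le> B"
proof -
  define U where "U x = (\<Sum>\<^sub>\<infinity>m. c m * emode m x)" for x
  have lim: "uniform_limit UNIV (fourier_sum c) U (finite_subsets_at_top UNIV)"
    unfolding U_def[abs_def] fourier_sum_def[abs_def]
    by (rule Weierstrass_m_test_general[OF _ c]) (simp add: norm_mult)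
  have cont: "continuous_on UNIV U"
    by (rule uniform_limit_theorem[OF _ lim])
       (simp_all add: fourier_sum_def[abs_def] continuous_intros continuous_emode)
  have U: "square_integrable U"
    by (rule square_integrable_continuous[OF continuous_on_subset[OF cont]]) simp
  have per: "periodic U"
    using periodic_emode by (simp add: periodic_def U_def)
  \<comment> \<open>All of the remaining claims follow by comparing \<open>U\<close> with one uniformly close partial sum.\<close>
  have approx: "\<exists>F. finite F \<and> A \<subseteq> F \<and> (\<forall>x. cmod (fourier_sum c F x - U x) < e)"
    if "e > 0" "finite A" for e A
  proof -
    have "\<forall>\<^sub>F F in finite_subsets_at_top UNIV. \<forall>x\<in>UNIV. dist (fourier_sum c F x) (U x) < e"
      using lim \<open>e > 0\<close> by (rule uniform_limitD)
    moreover have "\<forall>\<^sub>F F in finite_subsets_at_top UNIV. finite F \<and> A \<subseteq> F"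
      using that by (auto simp: eventually_finite_subsets_at_top)
    ultimately have "\<forall>\<^sub>F F in finite_subsets_at_top UNIV.
        finite F \<and> A \<subseteq> F \<and> (\<forall>x. cmod (fourier_sum c F x - U x) < e)"
      by eventually_elim (auto simp: dist_norm)
    then show ?thesis
      by (rule eventually_happens'[OF finite_subsets_at_top_neq_bot])
  qed
  have measure: "measure period_measure (space period_measure) = 2 * pi"
    by (simp add: measure_restrict_space)
  have coeff: "fourier_coeff U m = c m" for m
  proof -
    have "cmod (c m - fourier_coeff U m) \<le> e" if "e > 0" for e
    proof -
      obtain F where F: "finite F" "m \<in> F" "\<And>x. cmod (fourier_sum c F x - U x) < e"
        using approx[OF \<open>e > 0\<close>, of "{m}"] by auto
      have d: "square_integrable (\<lambda>x. fourier_sum c F x + (-1) * U x)"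
        by (intro square_integrable_add square_integrable_cmult square_integrable_fourier_sum U)
      have "c m - fourier_coeff U m = fourier_coeff (\<lambda>x. fourier_sum c F x + (-1) * U x) m"
        using F by (simp only: fourier_coeff_add square_integrable_fourier_sum U
            square_integrable_cmult fourier_coeff_cmult) (simp add: fourier_coeff_fourier_sum)
      also have "cmod \<dots> \<le>
          integral\<^sup>L period_measure (\<lambda>x. cmod ((fourier_sum c F x + (-1) * U x) * emode (- m) x)) / (2 * pi)"
        unfolding fourier_coeff_def norm_divide
        by (intro divide_mono) (auto intro!: integral_norm_bound)
      also have "\<dots> \<le> integral\<^sup>L period_measure (\<lambda>x. e) / (2 * pi)"
        using F(3) by (intro divide_right_mono integral_mono integrable_norm square_integrable_mult d
            square_integrable_emode) (auto simp: norm_mult less_imp_le)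
      also have "\<dots> = e" using measure by simp
      finally show ?thesis .
    qed
    then have "cmod (c m - fourier_coeff U m) \<le> 0" by (rule field_le_epsilon) simp
    then show ?thesis by simp
  qed
  have mean: "integral\<^sup>L period_measure U = 0"
    using coeff[of 0] \<open>c 0 = 0\<close> by (simp add: fourier_coeff_def)
  have zm: "zero_mean_L2 U"
    using U per mean by (auto simp: zero_mean_L2_def square_integrable_def)
  have norm: "integral\<^sup>L period_measure (\<lambda>x. (cmod (U x))\<^sup>2) \<le> B"
    if B: "\<And>A. finite A \<Longrightarrow> 2 * pi * (\<Sum>m\<in>A. (cmod (c m))\<^sup>2) \<le> B" for B
  proof (rule field_le_epsilon)
    fix e :: real assume "e > 0"
    define \<delta> where "\<delta> = sqrt (e / (2 * pi))"
    have "\<delta> > 0" using \<open>e > 0\<close> by (simp add: \<delta>_def)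
    then obtain F where F: "finite F" "\<And>x. cmod (fourier_sum c F x - U x) < \<delta>"
      using approx[of \<delta> "{}"] by auto
    have "fourier_coeff U = c" using coeff by auto
    then have "integral\<^sup>L period_measure (\<lambda>x. (cmod (U x))\<^sup>2) =
        integral\<^sup>L period_measure (\<lambda>x. (cmod (U x - fourier_sum c F x))\<^sup>2) +
        2 * pi * (\<Sum>m\<in>F. (cmod (c m))\<^sup>2)"
      using integral_norm_minus_fourier_sum[OF U F(1)] by simp
    also have "integral\<^sup>L period_measure (\<lambda>x. (cmod (U x - fourier_sum c F x))\<^sup>2) \<le>
        integral\<^sup>L period_measure (\<lambda>x. \<delta>\<^sup>2)"
    proof (rule integral_mono)
      show "integrable period_measure (\<lambda>x. (cmod (U x - fourier_sum c F x))\<^sup>2)"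
        by (intro square_integrableD square_integrable_diff U square_integrable_fourier_sum)
      show "(cmod (U x - fourier_sum c F x))\<^sup>2 \<le> \<delta>\<^sup>2" for x
        using F(2)[of x] by (intro power_mono) (auto simp: norm_minus_commute)
    qed simp
    also have "integral\<^sup>L period_measure (\<lambda>x. \<delta>\<^sup>2) = e"
      using measure \<open>e > 0\<close> by (simp add: \<delta>_def)
    finally show "integral\<^sup>L period_measure (\<lambda>x. (cmod (U x))\<^sup>2) \<le> B + e"
      using B[OF F(1)] by simp
  qed
  have "L2_eq U U" using zm by (simp add: L2_eq_def)
  then have "L2per_coeff (abs_L2per U) m = c m"
    "(norm (abs_L2per U))\<^sup>2 = integral\<^sup>L period_measure (\<lambda>x. (cmod (U x))\<^sup>2)" for m
    using coeff
    by (simp_all add: L2per_coeff.abs_eq inner_L2per.abs_eq inner_L2per_self power2_norm_eq_inner[of "abs_L2per U"])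
  with norm show ?thesis by (intro that[of "abs_L2per U"]) simp_all
qed

text \<open>
  One direction tests with the modes \<open>emode (- m)\<close>.  For the other, a smooth test function is replaced
  by its Fourier series on both sides, where the coefficient identity applies term by term.
\<close>

lemma weak_deriv_iff_coeff:
  "weak_deriv k u v \<longleftrightarrow> (\<forall>m. L2per_coeff v m = (\<i> * of_int m) ^ k * L2per_coeff u m)"
proof transfer
  fix k f g assume "L2_eq f f" "L2_eq g g"
  then have f: "square_integrable f" and g: "square_integrable g"
    by (auto simp: L2_eq_def square_integrable_zero_mean_L2)
  have sign: "(- 1) ^ k * (- z) ^ k = z ^ k" for z :: complex
    unfolding power_mult_distrib[symmetric] by simp
  show "(\<forall>\<phi>. smooth \<phi> \<and> periodic \<phi> \<longrightarrow>
      integral\<^sup>L period_measure (\<lambda>x. f x * iter_deriv k \<phi> x) =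
      (-1) ^ k * integral\<^sup>L period_measure (\<lambda>x. g x * \<phi> x)) \<longleftrightarrow>
    (\<forall>m. fourier_coeff g m = (\<i> * of_int m) ^ k * fourier_coeff f m)"
    (is "?weak \<longleftrightarrow> ?coeff")
  proof (intro iffI allI impI)
    fix m assume ?weak
    then have "integral\<^sup>L period_measure (\<lambda>x. f x * iter_deriv k (emode (- m)) x) =
        (-1) ^ k * integral\<^sup>L period_measure (\<lambda>x. g x * emode (- m) x)"
      using smooth_emode periodic_emode by blast
    also have "(\<lambda>x. f x * iter_deriv k (emode (- m)) x) =
        (\<lambda>x. (- (\<i> * of_int m)) ^ k * (f x * emode (- m) x))"
      by (simp add: iter_deriv_emode mult.left_commute fun_eq_iff)
    also have "integral\<^sup>L period_measure \<dots> =
        (- (\<i> * of_int m)) ^ k * integral\<^sup>L period_measure (\<lambda>x. f x * emode (- m) x)"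
      by (rule integral_mult_right_zero)
    finally have "(- 1) ^ k * ((- (\<i> * of_int m)) ^ k * fourier_coeff f m) =
        (- 1) ^ k * ((- 1) ^ k * fourier_coeff g m)"
      by (simp add: fourier_coeff_def)
    then show "fourier_coeff g m = (\<i> * of_int m) ^ k * fourier_coeff f m"
      unfolding mult.assoc[symmetric] sign using sign[of 1] by simp
  next
    fix \<phi> assume ?coeff and \<phi>: "smooth \<phi> \<and> periodic \<phi>"
    then have eq: "(- 1) ^ k * (\<phi>' * fourier_coeff g (- m)) =
        (\<i> * of_int m) ^ k * \<phi>' * fourier_coeff f (- m)" for \<phi>' m
      using sign[of "\<i> * of_int m"] by (simp add: mult_ac)
    have "(\<lambda>N. (- 1) ^ k * (2 * pi * (\<Sum>m\<in>{- int N..int N}. fourier_coeff \<phi> m * fourier_coeff g (- m))))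
        \<longlonglongrightarrow> (- 1) ^ k * integral\<^sup>L period_measure (\<lambda>x. g x * \<phi> x)"
      using integral_mult_smooth[OF g, of \<phi> 0] \<phi>
      by (intro tendsto_mult_left) (simp add: iter_deriv_def)
    moreover have "(\<Sum>m\<in>{- int N..int N}. (\<i> * of_int m) ^ k * fourier_coeff \<phi> m * fourier_coeff f (- m)) =
        (- 1) ^ k * (\<Sum>m\<in>{- int N..int N}. fourier_coeff \<phi> m * fourier_coeff g (- m))" for N
      by (simp only: eq[symmetric] sum_distrib_left)
    ultimately show "integral\<^sup>L period_measure (\<lambda>x. f x * iter_deriv k \<phi> x) =
        (-1) ^ k * integral\<^sup>L period_measure (\<lambda>x. g x * \<phi> x)"
      using LIMSEQ_unique[OF integral_mult_smooth[OF f, of \<phi> k]] \<phi>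
      by (simp only: mult.left_commute)
  qed
qed

lemma weak_deriv_imp_wderiv:
  assumes "weak_deriv k u v"
  shows "wderiv k u = v"
  unfolding wderiv_def
proof (rule the_equality[where P = "weak_deriv k u", OF assms])
  fix w assume "weak_deriv k u w"
  then show "w = v"
    using assms by (intro L2per_eqI) (simp add: weak_deriv_iff_coeff)
qed

lemma L2per_coeff_wderiv:
  assumes "u \<in> sobolev s" "k \<le> s"
  shows "L2per_coeff (wderiv k u) m = (\<i> * of_int m) ^ k * L2per_coeff u m"
proof -
  obtain v where v: "weak_deriv k u v" using assms by (auto simp: sobolev_def)
  then show ?thesis by (simp add: weak_deriv_imp_wderiv weak_deriv_iff_coeff)
qed

section \<open>The symbol at high frequencies\<close>

text \<open>
  The diagonal entries of the symbol at frequency \<open>m\<close> are \<open>even_symb\<close> of the coefficients of the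
  first and second row, and the off-diagonal entries are \<open>\<i>\<close> times their \<open>odd_symb\<close>.
\<close>

definition even_symb :: "nat \<Rightarrow> (nat \<Rightarrow> real) \<Rightarrow> int \<Rightarrow> real"
  where "even_symb n c m = (\<Sum>k\<le>n. c (2*k) * (- 1) ^ k * of_int m ^ (2*k))"

definition odd_symb :: "nat \<Rightarrow> (nat \<Rightarrow> real) \<Rightarrow> int \<Rightarrow> real"
  where "odd_symb n c m = (\<Sum>k\<le>n. c (2*k+1) * (- 1) ^ k * of_int m ^ (2*k+1))"

lemma abs_sum_powers_le:
  fixes t :: real
  assumes "\<bar>t\<bar> \<ge> 1" and "\<And>k. k < n \<Longrightarrow> e k \<le> d"
  shows "\<bar>\<Sum>k<n. c k * (- 1) ^ k * t ^ e k\<bar> \<le> (\<Sum>k<n. \<bar>c k\<bar>) * \<bar>t\<bar> ^ d"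
proof -
  have "\<bar>\<Sum>k<n. c k * (- 1) ^ k * t ^ e k\<bar> \<le> (\<Sum>k<n. \<bar>c k * (- 1) ^ k * t ^ e k\<bar>)"
    by (rule sum_abs)
  also have "\<dots> \<le> (\<Sum>k<n. \<bar>c k\<bar> * \<bar>t\<bar> ^ d)"
    using assms by (intro sum_mono) (auto simp: abs_mult power_abs intro!: mult_left_mono power_increasing)
  finally show ?thesis by (simp add: sum_distrib_right)
qed

lemma odd_symb_le:
  assumes "n \<ge> 1" "c (2*n+1) = 0"
  shows "\<exists>A\<ge>0. \<forall>m. m \<noteq> 0 \<longrightarrow> \<bar>odd_symb n c m\<bar> \<le> A * \<bar>of_int m\<bar> ^ (2*n - 1)"
proof (intro exI conjI allI impI)
  fix m :: int assume "m \<noteq> 0"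
  then have "\<bar>real_of_int m\<bar> \<ge> 1" by linarith
  then have "\<bar>\<Sum>k<n. c (2*k+1) * (- 1) ^ k * real_of_int m ^ (2*k+1)\<bar> \<le>
      (\<Sum>k<n. \<bar>c (2*k+1)\<bar>) * \<bar>of_int m\<bar> ^ (2*n - 1)"
    by (intro abs_sum_powers_le) auto
  moreover have "odd_symb n c m = (\<Sum>k<n. c (2*k+1) * (- 1) ^ k * real_of_int m ^ (2*k+1))"
    using assms by (simp add: odd_symb_def flip: lessThan_Suc_atMost)
  ultimately show "\<bar>odd_symb n c m\<bar> \<le> (\<Sum>k<n. \<bar>c (2*k+1)\<bar>) * \<bar>of_int m\<bar> ^ (2*n - 1)" by simp
qed (simp add: sum_nonneg)

lemma even_symb_ge:
  assumes "n \<ge> 1"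
  shows "\<exists>A\<ge>0. \<forall>m. m \<noteq> 0 \<longrightarrow>
    \<bar>c (2*n)\<bar> * \<bar>of_int m\<bar> ^ (2*n) - A * \<bar>of_int m\<bar> ^ (2*n - 1) \<le> \<bar>even_symb n c m\<bar>"
proof (intro exI conjI allI impI)
  fix m :: int assume "m \<noteq> 0"
  define low where "low = (\<Sum>k<n. c (2*k) * (- 1) ^ k * real_of_int m ^ (2*k))"
  from \<open>m \<noteq> 0\<close> have "\<bar>real_of_int m\<bar> \<ge> 1" by linarith
  then have "\<bar>low\<bar> \<le> (\<Sum>k<n. \<bar>c (2*k)\<bar>) * \<bar>of_int m\<bar> ^ (2*n - 1)"
    unfolding low_def by (intro abs_sum_powers_le) auto
  moreover have "even_symb n c m = low + c (2*n) * (- 1) ^ n * real_of_int m ^ (2*n)"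
    by (simp add: even_symb_def low_def flip: lessThan_Suc_atMost)
  moreover have "\<bar>c (2*n) * (- 1) ^ n * real_of_int m ^ (2*n)\<bar> = \<bar>c (2*n)\<bar> * \<bar>of_int m\<bar> ^ (2*n)"
    by (simp add: abs_mult power_abs)
  ultimately show "\<bar>c (2*n)\<bar> * \<bar>of_int m\<bar> ^ (2*n) - (\<Sum>k<n. \<bar>c (2*k)\<bar>) * \<bar>of_int m\<bar> ^ (2*n - 1) \<le>
      \<bar>even_symb n c m\<bar>" by linarith
qed (simp add: sum_nonneg)

text \<open>
  This is where the imaginary axis enters: the diagonal of the symbol is real, so its
  distance to \<open>\<i> * \<omega>\<close> grows both with \<open>\<bar>\<omega>\<bar>\<close> and with its own size.
\<close>

lemma abs_le_norm_imaginary_minus_real: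
  fixes \<omega> p :: real
  shows "\<bar>p\<bar> \<le> cmod (\<i> * \<omega> - p)" "\<bar>\<omega>\<bar> \<le> cmod (\<i> * \<omega> - p)"
  using abs_Re_le_cmod[of "\<i> * \<omega> - p"] abs_Im_le_cmod[of "\<i> * \<omega> - p"] by auto

text \<open>
  If \<open>\<bar>m\<bar>\<close> is at least a fixed radius \<open>R\<close>, then the leading term of the diagonal entry beats all terms of
  order \<open>\<bar>m\<bar> ^ (2*n - 1)\<close>.  The finitely many frequencies below \<open>R\<close> are covered by \<open>\<bar>\<omega>\<bar>\<close> instead,
  provided that \<open>\<omega>\<^sub>0\<close> exceeds what is needed at frequency \<open>R\<close>.
\<close>

lemma diagonal_symb_ge:
  assumes n: "n \<ge> 1" and lead: "c (2*n) \<noteq> 0" and "B \<ge> 0"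
  shows "\<exists>\<omega>\<^sub>0>(0::real). \<exists>\<kappa>>0. \<forall>\<omega>::real. \<forall>m. \<bar>\<omega>\<bar> \<ge> \<omega>\<^sub>0 \<longrightarrow> m \<noteq> 0 \<longrightarrow>
    B * \<bar>of_int m\<bar> ^ (2*n - 1) \<le> cmod (\<i> * \<omega> - even_symb n c m) \<and>
    \<kappa> * \<bar>of_int m\<bar> ^ (2*n) \<le> cmod (\<i> * \<omega> - even_symb n c m)"
proof -
  define a where "a = \<bar>c (2*n)\<bar>"
  have "a > 0" using lead by (simp add: a_def)
  obtain A where A: "A \<ge> 0" "\<And>m. m \<noteq> 0 \<Longrightarrow>
      a * \<bar>of_int m\<bar> ^ (2*n) - A * \<bar>of_int m\<bar> ^ (2*n - 1) \<le> \<bar>even_symb n c m\<bar>"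
    using even_symb_ge[OF n, of c] unfolding a_def by blast
  \<comment> \<open>With \<open>D\<close> at least \<open>A\<close>, the first estimate also absorbs the error term in the second one.\<close>
  define D where "D = max A B"
  have "D \<ge> 0" "A \<le> D" "B \<le> D" using A(1) by (auto simp: D_def)
  define R where "R = (A + D) / a"
  have "R \<ge> 0" using \<open>a > 0\<close> A(1) \<open>D \<ge> 0\<close> by (simp add: R_def)
  define \<omega>\<^sub>0 where "\<omega>\<^sub>0 = D * R ^ (2*n - 1) + 1"
  show ?thesis
  proof (rule exI[of _ \<omega>\<^sub>0], rule conjI, goal_cases)
    case 1
    show ?case using \<open>D \<ge> 0\<close> \<open>R \<ge> 0\<close> by (simp add: \<omega>\<^sub>0_def add_nonneg_pos)
  next
    case 2
    show ?case
    proof (intro exI[of _ "a / 2"] conjI[rotated] allI impI)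
      fix \<omega> :: real and m :: int
      assume \<omega>: "\<bar>\<omega>\<bar> \<ge> \<omega>\<^sub>0" and m: "m \<noteq> 0"
      define t where "t = \<bar>real_of_int m\<bar>"
      let ?P = "cmod (\<i> * \<omega> - even_symb n c m)"
      have "t \<ge> 0" by (simp add: t_def)
      have step: "t ^ (2*n) = t * t ^ (2*n - 1)"
        using n by (simp flip: power_Suc)
      have p: "a * t ^ (2*n) - A * t ^ (2*n - 1) \<le> ?P"
        using A(2)[OF m] abs_le_norm_imaginary_minus_real(1)[of "even_symb n c m" \<omega>]
        unfolding t_def by linarith
      have main: "D * t ^ (2*n - 1) \<le> ?P"
      proof (cases "R \<le> t")
        case True
        then have "A + D \<le> a * t" using \<open>a > 0\<close> by (simp add: R_def field_simps)
        then have "(A + D) * t ^ (2*n - 1) \<le> a * t * t ^ (2*n - 1)"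
          by (rule mult_right_mono) (simp add: \<open>t \<ge> 0\<close>)
        then show ?thesis using p by (simp add: step distrib_right mult.assoc)
      next
        case False
        then have "D * t ^ (2*n - 1) \<le> D * R ^ (2*n - 1)"
          using \<open>t \<ge> 0\<close> \<open>D \<ge> 0\<close> by (intro mult_left_mono power_mono) auto
        then show ?thesis
          using \<omega> abs_le_norm_imaginary_minus_real(2)[of \<omega> "even_symb n c m"]
          by (simp add: \<omega>\<^sub>0_def)
      qed
      have le: "B * t ^ (2*n - 1) \<le> D * t ^ (2*n - 1)" "A * t ^ (2*n - 1) \<le> D * t ^ (2*n - 1)"
        using \<open>t \<ge> 0\<close> \<open>A \<le> D\<close> \<open>B \<le> D\<close> by (auto intro!: mult_right_mono)
      show "B * \<bar>of_int m\<bar> ^ (2*n - 1) \<le> ?P"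
        using main le unfolding t_def by linarith
      show "a / 2 * \<bar>of_int m\<bar> ^ (2*n) \<le> ?P"
        using main le p unfolding t_def by linarith
    qed (use \<open>a > 0\<close> in simp)
  qed
qed

text \<open>
  Each column of \<open>\<i> * \<omega> - M\<^sub>m\<close> is dominated by its diagonal entry with a factor of two to spare, and
  the diagonal entries grow like \<open>\<bar>m\<bar> ^ (2*n)\<close>.  The first part gives the resolvent bound, the second
  puts the solution into the domain.
\<close>

definition diagonally_dominant :: "nat \<Rightarrow> (nat \<Rightarrow> nat \<Rightarrow> real) \<Rightarrow> real \<Rightarrow> real \<Rightarrow> bool"
  where "diagonally_dominant n a \<omega> \<kappa> \<longleftrightarrow> (\<forall>m. m \<noteq> 0 \<longrightarrow>
    2 * \<bar>odd_symb n (a 2) m\<bar> \<le> cmod (\<i> * \<omega> - even_symb n (a 1) m) \<and>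
    2 * \<bar>odd_symb n (a 1) m\<bar> \<le> cmod (\<i> * \<omega> - even_symb n (a 2) m) \<and>
    \<kappa> * \<bar>of_int m\<bar> ^ (2*n) \<le> cmod (\<i> * \<omega> - even_symb n (a 1) m) \<and>
    \<kappa> * \<bar>of_int m\<bar> ^ (2*n) \<le> cmod (\<i> * \<omega> - even_symb n (a 2) m))"

lemma eventually_diagonally_dominant:
  assumes n: "n \<ge> 1" and D: "cond_D n a"
  shows "\<exists>\<omega>\<^sub>0>0. \<exists>\<kappa>>0. \<forall>\<omega>. \<bar>\<omega>\<bar> \<ge> \<omega>\<^sub>0 \<longrightarrow> diagonally_dominant n a \<omega> \<kappa>"
proof -
  obtain A1 where A1: "A1 \<ge> 0" "\<And>m. m \<noteq> 0 \<Longrightarrow> \<bar>odd_symb n (a 1) m\<bar> \<le> A1 * \<bar>of_int m\<bar> ^ (2*n - 1)"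
    using odd_symb_le[OF n, of "a 1"] D by (auto simp: cond_D_def)
  obtain A2 where A2: "A2 \<ge> 0" "\<And>m. m \<noteq> 0 \<Longrightarrow> \<bar>odd_symb n (a 2) m\<bar> \<le> A2 * \<bar>of_int m\<bar> ^ (2*n - 1)"
    using odd_symb_le[OF n, of "a 2"] D by (auto simp: cond_D_def)
  obtain \<omega>1 \<kappa>1 where 1: "\<omega>1 > 0" "\<kappa>1 > 0" "\<And>\<omega> m. \<bar>\<omega>\<bar> \<ge> \<omega>1 \<Longrightarrow> m \<noteq> 0 \<Longrightarrow>
      2 * A2 * \<bar>of_int m\<bar> ^ (2*n - 1) \<le> cmod (\<i> * complex_of_real \<omega> - even_symb n (a 1) m) \<and>
      \<kappa>1 * \<bar>of_int m\<bar> ^ (2*n) \<le> cmod (\<i> * \<omega> - even_symb n (a 1) m)"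
    using diagonal_symb_ge[OF n, of "a 1" "2 * A2"] D A2(1) by (auto simp: cond_D_def)
  obtain \<omega>2 \<kappa>2 where 2: "\<omega>2 > 0" "\<kappa>2 > 0" "\<And>\<omega> m. \<bar>\<omega>\<bar> \<ge> \<omega>2 \<Longrightarrow> m \<noteq> 0 \<Longrightarrow>
      2 * A1 * \<bar>of_int m\<bar> ^ (2*n - 1) \<le> cmod (\<i> * complex_of_real \<omega> - even_symb n (a 2) m) \<and>
      \<kappa>2 * \<bar>of_int m\<bar> ^ (2*n) \<le> cmod (\<i> * \<omega> - even_symb n (a 2) m)"
    using diagonal_symb_ge[OF n, of "a 2" "2 * A1"] D A1(1) by (auto simp: cond_D_def)
  have "diagonally_dominant n a \<omega> (min \<kappa>1 \<kappa>2)" if \<omega>: "\<bar>\<omega>\<bar> \<ge> max \<omega>1 \<omega>2" for \<omega>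
    unfolding diagonally_dominant_def
  proof (intro allI impI)
    fix m :: int assume m: "m \<noteq> 0"
    have "min \<kappa>1 \<kappa>2 * \<bar>real_of_int m\<bar> ^ (2*n) \<le> \<kappa>1 * \<bar>of_int m\<bar> ^ (2*n)"
      "min \<kappa>1 \<kappa>2 * \<bar>real_of_int m\<bar> ^ (2*n) \<le> \<kappa>2 * \<bar>of_int m\<bar> ^ (2*n)"
      by (auto intro!: mult_right_mono)
    then show "2 * \<bar>odd_symb n (a 2) m\<bar> \<le> cmod (\<i> * \<omega> - even_symb n (a 1) m) \<and>
        2 * \<bar>odd_symb n (a 1) m\<bar> \<le> cmod (\<i> * \<omega> - even_symb n (a 2) m) \<and>
        min \<kappa>1 \<kappa>2 * \<bar>of_int m\<bar> ^ (2*n) \<le> cmod (\<i> * \<omega> - even_symb n (a 1) m) \<and>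
        min \<kappa>1 \<kappa>2 * \<bar>of_int m\<bar> ^ (2*n) \<le> cmod (\<i> * \<omega> - even_symb n (a 2) m)"
      using 1(3)[OF _ m, of \<omega>] 2(3)[OF _ m, of \<omega>] A1(2)[OF m] A2(2)[OF m] \<omega>
      by (intro conjI) auto
  qed
  then show ?thesis using 1 2
    by (intro exI[of _ "max \<omega>1 \<omega>2"] exI[of _ "min \<kappa>1 \<kappa>2"] conjI allI impI) auto
qed

text \<open>
  Solving each equation for its diagonal term and adding, the off-diagonal terms are at most half of
  the left-hand side and can be absorbed.
\<close>

lemma dominant_system_bound:
  fixes P Q x y f g :: complex and r s :: real
  assumes "2 * \<bar>s\<bar> \<le> cmod P" "2 * \<bar>r\<bar> \<le> cmod Q"
    and f: "P * x - \<i> * r * y = f" and g: "Q * y - \<i> * s * x = g"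
  shows "cmod P * cmod x + cmod Q * cmod y \<le> 2 * (cmod f + cmod g)"
proof -
  have "P * x = f + \<i> * r * y" "Q * y = g + \<i> * s * x" using f g by (auto simp: algebra_simps)
  then have "cmod P * cmod x \<le> cmod f + \<bar>r\<bar> * cmod y" "cmod Q * cmod y \<le> cmod g + \<bar>s\<bar> * cmod x"
    using norm_triangle_ineq[of f "\<i> * r * y"] norm_triangle_ineq[of g "\<i> * s * x"]
    by (auto simp: norm_mult[symmetric]) (auto simp: norm_mult)
  moreover have "2 * (\<bar>s\<bar> * cmod x) \<le> cmod P * cmod x" "2 * (\<bar>r\<bar> * cmod y) \<le> cmod Q * cmod y"
    using mult_right_mono[OF assms(2), of "cmod y"] mult_right_mono[OF assms(1), of "cmod x"]
    by (simp_all add: mult.assoc)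
  moreover have "X + Y \<le> 2 * (F + G)"
    if "X \<le> F + b" "Y \<le> G + a" "2 * a \<le> X" "2 * b \<le> Y" for X Y F G a b :: real
    using that by argo
  ultimately show ?thesis by blast
qed

lemma dominant_system_solvable:
  fixes P Q f g :: complex and r s :: real
  assumes "2 * \<bar>s\<bar> \<le> cmod P" "2 * \<bar>r\<bar> \<le> cmod Q" "P \<noteq> 0" "Q \<noteq> 0"
  shows "\<exists>x y. P * x - \<i> * r * y = f \<and> Q * y - \<i> * s * x = g"
proof -
  \<comment> \<open>The determinant of the system; the solution is given by Cramer's rule.\<close>
  define \<Delta> where "\<Delta> = P * Q + r * s"
  have "(2 * \<bar>s\<bar>) * (2 * \<bar>r\<bar>) \<le> cmod P * cmod Q"
    using assms by (intro mult_mono) auto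
  then have "cmod (r * s) < cmod (P * Q)"
    using assms by (simp add: norm_mult)
       (smt (verit, best) mult.commute mult_pos_pos zero_less_norm_iff)
  then have "\<Delta> \<noteq> 0"
    unfolding \<Delta>_def by (metis add_eq_0_iff less_irrefl norm_minus_cancel)
  have "P * ((Q * f + \<i> * r * g) / \<Delta>) - \<i> * r * ((\<i> * s * f + P * g) / \<Delta>) = (\<Delta> * f) / \<Delta>"
    "Q * ((\<i> * s * f + P * g) / \<Delta>) - \<i> * s * ((Q * f + \<i> * r * g) / \<Delta>) = (\<Delta> * g) / \<Delta>"
    unfolding \<Delta>_def times_divide_eq_right diff_divide_distrib[symmetric]
    by (simp_all add: algebra_simps)
  then show ?thesis
    using \<open>\<Delta> \<noteq> 0\<close>
    by (intro exI[of _ "(Q * f + \<i> * r * g) / \<Delta>"] exI[of _ "(\<i> * s * f + P * g) / \<Delta>"]) simp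
qed

section \<open>The resolvent\<close>

lemma imaginary_power_even: "(\<i> * of_int m) ^ (2*k) = (- 1) ^ k * complex_of_int m ^ (2*k)"
  by (simp only: power_mult_distrib power_mult[of \<i>] power2_i)

lemma imaginary_power_odd: "(\<i> * of_int m) ^ (2*k+1) = \<i> * ((- 1) ^ k * complex_of_int m ^ (2*k+1))"
  unfolding power_add imaginary_power_even by simp

lemma of_real_even_symb:
  "complex_of_real (even_symb n c m) = (\<Sum>k\<le>n. c (2*k) * (\<i> * of_int m) ^ (2*k))"
  unfolding imaginary_power_even by (simp add: even_symb_def mult.assoc)

lemma of_real_odd_symb:
  "\<i> * complex_of_real (odd_symb n c m) = (\<Sum>k\<le>n. c (2*k+1) * (\<i> * of_int m) ^ (2*k+1))"
  unfolding imaginary_power_odd by (simp add: odd_symb_def sum_distrib_left mult_ac)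

lemma L2per_coeff_even_part:
  assumes "u \<in> sobolev (2*n)"
  shows "L2per_coeff (\<Sum>k\<le>n. c (2*k) *\<^sub>R wderiv (2*k) u) m = even_symb n c m * L2per_coeff u m"
  using assms by (simp add: L2per_coeff_sum L2per_coeff_wderiv of_real_even_symb sum_distrib_right mult.assoc)

lemma L2per_coeff_odd_part:
  assumes "u \<in> sobolev (2*n)" "c (2*n+1) = 0"
  shows "L2per_coeff (\<Sum>k\<le>n. c (2*k+1) *\<^sub>R wderiv (2*k+1) u) m =
    \<i> * odd_symb n c m * L2per_coeff u m"
proof -
  \<comment> \<open>For \<open>k = n\<close> the derivative lies outside the range of \<open>u \<in> sobolev (2*n)\<close>, but its coefficient is \<open>0\<close>.\<close>
  have "c (2*k+1) * L2per_coeff (wderiv (2*k+1) u) m =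
      c (2*k+1) * (\<i> * of_int m) ^ (2*k+1) * L2per_coeff u m" if "k \<le> n" for k
  proof (cases "k = n")
    case False
    then show ?thesis using that assms(1) by (simp only: L2per_coeff_wderiv[of u "2*n"]) simp
  qed (use assms in simp)
  then show ?thesis
    unfolding of_real_odd_symb sum_distrib_right L2per_coeff_sum L2per_coeff_scaleR
    by (intro sum.cong) simp_all
qed

lemma shifted_L_op_eq_iff:
  assumes "cond_D n a" and u: "u \<in> sobolev (2*n)" and v: "v \<in> sobolev (2*n)"
  shows "shifted z (L_op n a) (u, v) = (f, g) \<longleftrightarrow> (\<forall>m.
    (z - even_symb n (a 1) m) * L2per_coeff u m - \<i> * odd_symb n (a 1) m * L2per_coeff v m = L2per_coeff f m \<and>
    (z - even_symb n (a 2) m) * L2per_coeff v m - \<i> * odd_symb n (a 2) m * L2per_coeff u m = L2per_coeff g m)"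
proof -
  have eq: "h = k \<longleftrightarrow> (\<forall>m. L2per_coeff h m = L2per_coeff k m)" for h k
    by (auto intro: L2per_eqI)
  have D: "a 1 (2*n+1) = 0" "a 2 (2*n+1) = 0" using assms by (auto simp: cond_D_def)
  show ?thesis
    unfolding shifted_def L_op_def prod.case fst_conv snd_conv diff_Pair prod.inject eq
      L2per_coeff_diff L2per_coeff_add L2per_coeff_scaleC
      L2per_coeff_even_part[OF u] L2per_coeff_even_part[OF v]
      L2per_coeff_odd_part[OF u, of "a 2", OF D(2)] L2per_coeff_odd_part[OF v, of "a 1", OF D(1)]
    by (auto simp: algebra_simps)
qed

lemma inverse_square_summable_on_int: "(\<lambda>m::int. 1 / (real_of_int m)\<^sup>2) summable_on UNIV"
proof -
  have *: "(\<lambda>m::int. 1 / (real_of_int m)\<^sup>2) summable_on range h"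
    if h: "inj h" "\<And>n. \<bar>h n\<bar> = int n" for h :: "nat \<Rightarrow> int"
  proof -
    have "(\<lambda>n. 1 / (real n)\<^sup>2) summable_on UNIV"
      using inverse_power_summable[of 2, where 'a = real]
      by (intro summable_nonneg_imp_summable_on) (auto simp: field_simps)
    moreover have "(real_of_int (h n))\<^sup>2 = (real n)\<^sup>2" for n
      by (metis h(2) of_int_abs of_int_of_nat_eq power2_abs)
    ultimately show ?thesis
      using summable_on_reindex[OF h(1), of "\<lambda>m. 1 / (real_of_int m)\<^sup>2"] by (simp add: o_def)
  qed
  have "(\<lambda>m::int. 1 / (real_of_int m)\<^sup>2) summable_on (range int \<union> range (\<lambda>n. - int n))"
    by (intro summable_on_union *) (auto simp: inj_on_def)
  also have "range int \<union> range (\<lambda>n. - int n) = UNIV"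
    by (auto simp: image_iff) (metis int_cases2)
  finally show ?thesis .
qed

text \<open>
  The hypothesis gains \<open>2 * n\<close> powers of \<open>m\<close> over square-summable sequences.  One of them is needed
  to make the product with a square-summable sequence summable, so \<open>2 * n - 1\<close> derivatives have
  absolutely convergent Fourier series.
\<close>

lemma derivative_coeffs_summable:
  fixes c :: "int \<Rightarrow> complex"
  assumes c: "\<And>m. m \<noteq> 0 \<Longrightarrow> \<kappa> * \<bar>of_int m\<bar> ^ (2*n) * cmod (c m) \<le>
      2 * (cmod (L2per_coeff f m) + cmod (L2per_coeff g m))"
    and "\<kappa> > 0" and j: "j < 2*n" and zero: "c 0 = 0"
  shows "(\<lambda>m. cmod ((\<i> * of_int m) ^ j * c m)) summable_on UNIV"
proof (rule summable_on_comparison_test)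
  let ?M = "\<lambda>m. 2 / \<kappa> * (1 / (real_of_int m)\<^sup>2 +
      ((cmod (L2per_coeff f m))\<^sup>2 + (cmod (L2per_coeff g m))\<^sup>2))"
  show "?M summable_on UNIV"
    by (intro summable_on_cmult_right summable_on_add inverse_square_summable_on_int
        L2per_coeff_square_summable)
  fix m :: int
  show "cmod ((\<i> * of_int m) ^ j * c m) \<le> ?M m"
  proof (cases "m = 0")
    case True
    then show ?thesis using zero \<open>\<kappa> > 0\<close> by simp
  next
    case False
    define t where "t = \<bar>real_of_int m\<bar>"
    define F where "F = cmod (L2per_coeff f m)"
    define G where "G = cmod (L2per_coeff g m)"
    have "t \<ge> 1" unfolding t_def using False by linarith
    have "t * t ^ j \<le> t ^ (2*n)"
      using j \<open>t \<ge> 1\<close> by (auto simp flip: power_Suc intro!: power_increasing)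
    then have "\<kappa> * cmod (c m) * (t * t ^ j) \<le> \<kappa> * cmod (c m) * t ^ (2*n)"
      using \<open>\<kappa> > 0\<close> by (intro mult_left_mono) auto
    also have "\<dots> \<le> 2 * (F + G)"
      using c[OF False] by (simp add: t_def F_def G_def mult_ac)
    finally have "t ^ j * cmod (c m) \<le> 2 / \<kappa> * ((1 / t) * F + (1 / t) * G)"
      using \<open>\<kappa> > 0\<close> \<open>t \<ge> 1\<close> by (simp add: field_simps)
    also have "\<dots> \<le> 2 / \<kappa> * ((1 / t)\<^sup>2 + (F\<^sup>2 + G\<^sup>2))"
    proof (rule mult_left_mono)
      show "(1 / t) * F + (1 / t) * G \<le> (1 / t)\<^sup>2 + (F\<^sup>2 + G\<^sup>2)"
        using sum_squares_bound[of "1 / t" F] sum_squares_bound[of "1 / t" G]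
          zero_le_power2[of F] zero_le_power2[of G] unfolding mult.assoc by linarith
    qed (use \<open>\<kappa> > 0\<close> in simp)
    finally show ?thesis
      using \<open>\<kappa> > 0\<close> by (simp add: norm_mult norm_power t_def F_def G_def power_divide)
  qed
qed simp

text \<open>
  Mode by mode, \<open>\<bar>\<omega>\<bar>\<close> times the coefficients of \<open>U\<close> is at most twice the sum of those of \<open>F\<close>; squaring
  and summing gives the norm estimate.  The decay of the coefficients is needed as well, because the
  norm of \<open>U\<close> is controlled by its coefficients through an absolutely convergent Fourier series.
\<close>

lemma L_op_resolvent_estimate:
  assumes D: "cond_D n a" and dom: "diagonally_dominant n a \<omega> \<kappa>" and "\<kappa> > 0" "\<omega> \<noteq> 0" "n \<ge> 1"
    and U: "U \<in> L_dom n" and eq: "shifted (\<i> * \<omega>) (L_op n a) U = F"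
  shows "norm U \<le> 4 / \<bar>\<omega>\<bar> * norm F"
proof -
  obtain u v where uv: "U = (u, v)" "u \<in> sobolev (2*n)" "v \<in> sobolev (2*n)"
    using U by (auto simp: L_dom_def)
  obtain f g where fg: "F = (f, g)" by (cases F)
  let ?x = "L2per_coeff u" and ?y = "L2per_coeff v"
  let ?f = "\<lambda>m. cmod (L2per_coeff f m)" and ?g = "\<lambda>m. cmod (L2per_coeff g m)"
  let ?P = "\<lambda>m. cmod (\<i> * \<omega> - even_symb n (a 1) m)"
  let ?Q = "\<lambda>m. cmod (\<i> * \<omega> - even_symb n (a 2) m)"
  have bound: "?P m * cmod (?x m) + ?Q m * cmod (?y m) \<le> 2 * (?f m + ?g m)" if "m \<noteq> 0" for m
    using eq dom that unfolding uv(1) fg shifted_L_op_eq_iff[OF D uv(2,3)] diagonally_dominant_def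
    by (intro dominant_system_bound) auto
  have component: "?P m * cmod (?x m) \<le> 2 * (?f m + ?g m)" "?Q m * cmod (?y m) \<le> 2 * (?f m + ?g m)"
    if "m \<noteq> 0" for m
    using bound[OF that] by (smt (verit) norm_ge_zero mult_nonneg_nonneg)+
  \<comment> \<open>Stated for a generic component \<open>w\<close> with diagonal weight \<open>S\<close>, since \<open>u\<close> and \<open>v\<close> are treated alike.\<close>
  have norm_bound: "(norm w)\<^sup>2 \<le> 8 / \<omega>\<^sup>2 * ((norm f)\<^sup>2 + (norm g)\<^sup>2)"
    if S: "\<And>m. m \<noteq> 0 \<Longrightarrow> S m * cmod (L2per_coeff w m) \<le> 2 * (?f m + ?g m)"
      and low: "\<And>m. \<bar>\<omega>\<bar> \<le> S m" and high: "\<And>m. m \<noteq> 0 \<Longrightarrow> \<kappa> * \<bar>of_int m\<bar> ^ (2*n) \<le> S m"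
    for w and S :: "int \<Rightarrow> real"
  proof -
    have pointwise: "(cmod (L2per_coeff w m))\<^sup>2 \<le> 8 / \<omega>\<^sup>2 * ((?f m)\<^sup>2 + (?g m)\<^sup>2)" for m
    proof (cases "m = 0")
      case False
      have "\<bar>\<omega>\<bar> * cmod (L2per_coeff w m) \<le> 2 * (?f m + ?g m)"
        using mult_right_mono[OF low, of "cmod (L2per_coeff w m)" m] S[OF False] by simp
      then have "(\<bar>\<omega>\<bar> * cmod (L2per_coeff w m))\<^sup>2 \<le> (2 * (?f m + ?g m))\<^sup>2"
        by (rule power_mono) simp
      also have "\<dots> \<le> 8 * ((?f m)\<^sup>2 + (?g m)\<^sup>2)"
        using sum_squares_bound[of "?f m" "?g m"] by (simp add: power2_eq_square algebra_simps)
      finally show ?thesis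
        using \<open>\<omega> \<noteq> 0\<close> by (simp add: power_mult_distrib field_simps)
    qed simp
    have "\<kappa> * \<bar>of_int m\<bar> ^ (2*n) * cmod (L2per_coeff w m) \<le> 2 * (?f m + ?g m)" if "m \<noteq> 0" for m
      using mult_right_mono[OF high[OF that], of "cmod (L2per_coeff w m)"] S[OF that] by simp
    from derivative_coeffs_summable[OF this \<open>\<kappa> > 0\<close>, of 0]
    have "(\<lambda>m. cmod (L2per_coeff w m)) summable_on UNIV" using \<open>n \<ge> 1\<close> by simp
    moreover have "2 * pi * (\<Sum>m\<in>A. (cmod (L2per_coeff w m))\<^sup>2) \<le>
        8 / \<omega>\<^sup>2 * ((norm f)\<^sup>2 + (norm g)\<^sup>2)" if "finite A" for A
    proof -
      have "2 * pi * (\<Sum>m\<in>A. (cmod (L2per_coeff w m))\<^sup>2) \<le>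
          2 * pi * (\<Sum>m\<in>A. 8 / \<omega>\<^sup>2 * ((?f m)\<^sup>2 + (?g m)\<^sup>2))"
        by (intro mult_left_mono sum_mono pointwise) simp
      also have "\<dots> = 8 / \<omega>\<^sup>2 * (2 * pi * (\<Sum>m\<in>A. (?f m)\<^sup>2) + 2 * pi * (\<Sum>m\<in>A. (?g m)\<^sup>2))"
        by (simp only: sum_distrib_left[symmetric] sum.distrib) (simp add: algebra_simps)
      also have "\<dots> \<le> 8 / \<omega>\<^sup>2 * ((norm f)\<^sup>2 + (norm g)\<^sup>2)"
        by (intro mult_left_mono add_mono L2per_Bessel that) simp
      finally show ?thesis .
    qed
    moreover obtain w' where "\<And>m. L2per_coeff w' m = L2per_coeff w m"
        "\<And>B. (\<And>A. finite A \<Longrightarrow> 2 * pi * (\<Sum>m\<in>A. (cmod (L2per_coeff w m))\<^sup>2) \<le> B) \<Longrightarrow> (norm w')\<^sup>2 \<le> B"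
      using absolutely_summable_fourier_series[of "L2per_coeff w"] calculation(1) L2per_coeff_zero_mode
      by blast
    moreover from this have "w' = w" by (intro L2per_eqI)
    ultimately show ?thesis by blast
  qed
  have "(norm u)\<^sup>2 \<le> 8 / \<omega>\<^sup>2 * ((norm f)\<^sup>2 + (norm g)\<^sup>2)"
    using dom by (intro norm_bound[where S = ?P] component abs_le_norm_imaginary_minus_real)
      (auto simp: diagonally_dominant_def)
  moreover have "(norm v)\<^sup>2 \<le> 8 / \<omega>\<^sup>2 * ((norm f)\<^sup>2 + (norm g)\<^sup>2)"
    using dom by (intro norm_bound[where S = ?Q] component abs_le_norm_imaginary_minus_real)
      (auto simp: diagonally_dominant_def)
  ultimately have "(norm u)\<^sup>2 + (norm v)\<^sup>2 \<le> (4 / \<bar>\<omega>\<bar>)\<^sup>2 * ((norm f)\<^sup>2 + (norm g)\<^sup>2)"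
  proof -
    have "(4 / \<bar>\<omega>\<bar>)\<^sup>2 = 8 / \<omega>\<^sup>2 + 8 / \<omega>\<^sup>2" by (simp add: power_divide)
    with \<open>(norm u)\<^sup>2 \<le> _\<close> \<open>(norm v)\<^sup>2 \<le> _\<close> show ?thesis
      by (simp only: distrib_right add_mono)
  qed
  then have "sqrt ((norm u)\<^sup>2 + (norm v)\<^sup>2) \<le> sqrt ((4 / \<bar>\<omega>\<bar>)\<^sup>2 * ((norm f)\<^sup>2 + (norm g)\<^sup>2))"
    by (rule real_sqrt_le_mono)
  then show ?thesis
    by (simp add: uv fg norm_Pair real_sqrt_mult)
qed

text \<open>
  The derivative of order \<open>2 * n\<close> of the solution is in general no better than the right-hand side, so
  its Fourier series need not converge absolutely.  It is read off from the equation itself: as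
  \<open>c (2*n) \<noteq> 0\<close>, it is a linear combination of \<open>f\<close> and derivatives of lower order, which are already
  known to exist.
\<close>

lemma top_derivative_from_equation:
  fixes x y :: "int \<Rightarrow> complex" and z :: complex
  assumes "n \<ge> 1" and lead: "c (2*n) \<noteq> 0" and "d (2*n+1) = 0"
    and W: "\<And>j m. j < 2*n \<Longrightarrow> L2per_coeff (W j) m = (\<i> * of_int m) ^ j * x m"
    and V: "\<And>j m. j < 2*n \<Longrightarrow> L2per_coeff (V j) m = (\<i> * of_int m) ^ j * y m"
    and eq: "\<And>m. (z - even_symb n c m) * x m - \<i> * odd_symb n d m * y m = L2per_coeff f m"
  shows "\<exists>w. \<forall>m. L2per_coeff w m = (\<i> * of_int m) ^ (2*n) * x m"
proof (intro exI allI)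
  let ?w = "(1 / c (2*n)) *\<^sub>R (z *\<^sub>C W 0 - (\<Sum>k<n. c (2*k) *\<^sub>R W (2*k)) -
    (\<Sum>k<n. d (2*k+1) *\<^sub>R V (2*k+1)) - f)"
  fix m
  define A where "A = L2per_coeff (\<Sum>k<n. c (2*k) *\<^sub>R W (2*k)) m"
  define B where "B = L2per_coeff (\<Sum>k<n. d (2*k+1) *\<^sub>R V (2*k+1)) m"
  define T where "T = (\<i> * of_int m) ^ (2*n) * x m"
  have "A = (\<Sum>k<n. c (2*k) * (\<i> * of_int m) ^ (2*k) * x m)"
    unfolding A_def L2per_coeff_sum by (intro sum.cong) (simp_all add: W)
  then have even: "even_symb n c m * x m = A + c (2*n) * T"
    unfolding of_real_even_symb lessThan_Suc_atMost[symmetric] sum.lessThan_Suc T_def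
    by (simp only: distrib_right sum_distrib_right mult.assoc)
  have "B = (\<Sum>k<n. d (2*k+1) * (\<i> * of_int m) ^ (2*k+1) * y m)"
    unfolding B_def L2per_coeff_sum by (intro sum.cong) (simp_all add: V)
  then have odd: "\<i> * odd_symb n d m * y m = B"
    unfolding of_real_odd_symb lessThan_Suc_atMost[symmetric] sum.lessThan_Suc \<open>d (2*n+1) = 0\<close>
    by (simp only: sum_distrib_right of_real_0 mult_zero_left add_0_right)
  have "c (2*n) * T = z * x m - A - B - L2per_coeff f m"
    using eq[of m] unfolding left_diff_distrib even odd by (simp add: algebra_simps)
  moreover have "L2per_coeff (W 0) m = x m" using W[of 0] \<open>n \<ge> 1\<close> by simp
  then have "L2per_coeff ?w m = of_real (1 / c (2*n)) * (z * x m - A - B - L2per_coeff f m)"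
    unfolding A_def B_def by (simp only: L2per_coeff_scaleR L2per_coeff_diff L2per_coeff_scaleC)
  ultimately have "L2per_coeff ?w m = of_real (1 / c (2*n)) * (c (2*n) * T)" by (simp only:)
  then show "L2per_coeff ?w m = (\<i> * of_int m) ^ (2*n) * x m"
    unfolding T_def[symmetric] using lead by simp
qed

text \<open>
  The symbol system is solved at every frequency.  The solutions decay fast enough for \<open>2 * n - 1\<close>
  derivatives to be defined by absolutely convergent series, and the last derivative comes from the
  equation.
\<close>

lemma L_op_resolvent_surj:
  assumes D: "cond_D n a" and dom: "diagonally_dominant n a \<omega> \<kappa>" and "\<kappa> > 0" "\<omega> \<noteq> 0" "n \<ge> 1"
  shows "\<exists>U\<in>L_dom n. shifted (\<i> * \<omega>) (L_op n a) U = F"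
proof -
  obtain f g where fg: "F = (f, g)" by (cases F)
  let ?P = "\<lambda>m. \<i> * \<omega> - even_symb n (a 1) m" and ?Q = "\<lambda>m. \<i> * \<omega> - even_symb n (a 2) m"
  have nz: "?P m \<noteq> 0" "?Q m \<noteq> 0" for m
    using abs_le_norm_imaginary_minus_real(2)[of \<omega>] \<open>\<omega> \<noteq> 0\<close>
    by (fastforce simp del: of_real_diff)+
  have dominant: "2 * \<bar>odd_symb n (a 2) m\<bar> \<le> cmod (?P m)" "2 * \<bar>odd_symb n (a 1) m\<bar> \<le> cmod (?Q m)"
    if "m \<noteq> 0" for m
    using dom that by (auto simp: diagonally_dominant_def)
  define system where "system m x y \<longleftrightarrow> (m = 0 \<longrightarrow> x = 0 \<and> y = 0) \<and>
      ?P m * x - \<i> * odd_symb n (a 1) m * y = L2per_coeff f m \<and>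
      ?Q m * y - \<i> * odd_symb n (a 2) m * x = L2per_coeff g m" for m x y
  have "\<exists>x y. system m x y" for m
  proof (cases "m = 0")
    case False
    then show ?thesis
      unfolding system_def using dominant_system_solvable[OF dominant nz] by blast
  next
    case True
    then show ?thesis unfolding system_def by (intro exI[of _ 0]) simp
  qed
  then obtain x y where xy: "\<And>m. system m (x m) (y m)" by metis
  have zero: "x 0 = 0" "y 0 = 0" using xy[of 0] by (auto simp: system_def)
  have x: "?P m * x m - \<i> * odd_symb n (a 1) m * y m = L2per_coeff f m"
    and y: "?Q m * y m - \<i> * odd_symb n (a 2) m * x m = L2per_coeff g m" for m
    using xy[of m] unfolding system_def by blast+
  have bound: "cmod (?P m) * cmod (x m) + cmod (?Q m) * cmod (y m) \<le>
      2 * (cmod (L2per_coeff f m) + cmod (L2per_coeff g m))" if "m \<noteq> 0" for m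
    by (rule dominant_system_bound[OF dominant[OF that] x y])
  have decay: "\<kappa> * \<bar>of_int m\<bar> ^ (2*n) * cmod (x m) \<le> 2 * (cmod (L2per_coeff f m) + cmod (L2per_coeff g m))"
    "\<kappa> * \<bar>of_int m\<bar> ^ (2*n) * cmod (y m) \<le> 2 * (cmod (L2per_coeff f m) + cmod (L2per_coeff g m))"
    if "m \<noteq> 0" for m
  proof -
    have "\<kappa> * \<bar>of_int m\<bar> ^ (2*n) * cmod (x m) \<le> cmod (?P m) * cmod (x m)"
      "\<kappa> * \<bar>of_int m\<bar> ^ (2*n) * cmod (y m) \<le> cmod (?Q m) * cmod (y m)"
      using dom that by (auto simp: diagonally_dominant_def intro!: mult_right_mono)
    moreover have "0 \<le> cmod (?P m) * cmod (x m)" "0 \<le> cmod (?Q m) * cmod (y m)" by simp_all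
    ultimately show
      "\<kappa> * \<bar>of_int m\<bar> ^ (2*n) * cmod (x m) \<le> 2 * (cmod (L2per_coeff f m) + cmod (L2per_coeff g m))"
      "\<kappa> * \<bar>of_int m\<bar> ^ (2*n) * cmod (y m) \<le> 2 * (cmod (L2per_coeff f m) + cmod (L2per_coeff g m))"
      using bound[OF that] by linarith+
  qed
  have realise: "\<exists>w. \<forall>m. L2per_coeff w m = (\<i> * of_int m) ^ j * c m"
    if c: "\<And>m. m \<noteq> 0 \<Longrightarrow> \<kappa> * \<bar>of_int m\<bar> ^ (2*n) * cmod (c m) \<le>
        2 * (cmod (L2per_coeff f m) + cmod (L2per_coeff g m))" and "c 0 = 0" "j < 2*n" for j c
  proof -
    have "(\<lambda>m. cmod ((\<i> * of_int m) ^ j * c m)) summable_on UNIV"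
      using c \<open>\<kappa> > 0\<close> \<open>j < 2*n\<close> \<open>c 0 = 0\<close> by (rule derivative_coeffs_summable)
    moreover have "(\<i> * of_int 0) ^ j * c 0 = 0" using \<open>c 0 = 0\<close> by simp
    ultimately obtain w where "\<And>m. L2per_coeff w m = (\<i> * of_int m) ^ j * c m"
      by (rule absolutely_summable_fourier_series) (use that in blast)
    then show ?thesis by blast
  qed
  have "\<exists>W. \<forall>j<2*n. \<forall>m. L2per_coeff (W j) m = (\<i> * of_int m) ^ j * x m"
    using realise[of x, OF decay(1) zero(1)] by (intro choice) blast
  then obtain W where W: "\<And>j m. j < 2*n \<Longrightarrow> L2per_coeff (W j) m = (\<i> * of_int m) ^ j * x m"
    by blast
  have "\<exists>V. \<forall>j<2*n. \<forall>m. L2per_coeff (V j) m = (\<i> * of_int m) ^ j * y m"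
    using realise[of y, OF decay(2) zero(2)] by (intro choice) blast
  then obtain V where V: "\<And>j m. j < 2*n \<Longrightarrow> L2per_coeff (V j) m = (\<i> * of_int m) ^ j * y m"
    by blast
  have lead: "a 1 (2*n) \<noteq> 0" "a 2 (2*n) \<noteq> 0" "a 1 (2*n+1) = 0" "a 2 (2*n+1) = 0"
    using D by (auto simp: cond_D_def)
  obtain w where w: "\<And>m. L2per_coeff w m = (\<i> * of_int m) ^ (2*n) * x m"
    using top_derivative_from_equation[of n "a 1" "a 1" W x V y, OF \<open>n \<ge> 1\<close> lead(1,3) W V x] by blast
  obtain w' where w': "\<And>m. L2per_coeff w' m = (\<i> * of_int m) ^ (2*n) * y m"
    using top_derivative_from_equation[of n "a 2" "a 2" V y W x, OF \<open>n \<ge> 1\<close> lead(2,4) V W y] by blast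
  have u: "L2per_coeff (W 0) m = x m" and v: "L2per_coeff (V 0) m = y m" for m
    using W[of 0] V[of 0] \<open>n \<ge> 1\<close> by simp_all
  have member: "h 0 \<in> sobolev (2*n)"
    if h: "\<And>j m. j < 2*n \<Longrightarrow> L2per_coeff (h j) m = (\<i> * of_int m) ^ j * c m"
      and t: "\<And>m. L2per_coeff t m = (\<i> * of_int m) ^ (2*n) * c m" for h c t
  proof -
    have "weak_deriv k (h 0) (if k < 2*n then h k else t)" if "k \<le> 2*n" for k
      unfolding weak_deriv_iff_coeff using that h[of 0] h[of k] t \<open>n \<ge> 1\<close> by auto
    then show ?thesis unfolding sobolev_def by blast
  qed
  have sob: "W 0 \<in> sobolev (2*n)" "V 0 \<in> sobolev (2*n)"
    by (rule member, fact W, fact w) (rule member, fact V, fact w')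
  have "shifted (\<i> * \<omega>) (L_op n a) (W 0, V 0) = F"
    unfolding fg shifted_L_op_eq_iff[OF D sob] u v x y by simp
  with sob show ?thesis unfolding L_dom_def by blast
qed

lemma sobolev_add: "u \<in> sobolev s \<Longrightarrow> v \<in> sobolev s \<Longrightarrow> u + v \<in> sobolev s"
  unfolding sobolev_def weak_deriv_iff_coeff mem_Collect_eq
  by (metis L2per_coeff_add distrib_left)

lemma sobolev_scaleR: "u \<in> sobolev s \<Longrightarrow> r *\<^sub>R u \<in> sobolev s"
  unfolding sobolev_def weak_deriv_iff_coeff mem_Collect_eq
  by (metis L2per_coeff_scaleR mult.left_commute)

lemma L_dom_add: "U \<in> L_dom n \<Longrightarrow> V \<in> L_dom n \<Longrightarrow> U + V \<in> L_dom n"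
  by (auto simp: L_dom_def sobolev_add)

lemma L_dom_scaleR: "U \<in> L_dom n \<Longrightarrow> r *\<^sub>R U \<in> L_dom n"
  by (auto simp: L_dom_def sobolev_scaleR)

lemma shifted_L_op_add:
  assumes D: "cond_D n a" and "U \<in> L_dom n" "V \<in> L_dom n"
  shows "shifted z (L_op n a) (U + V) = shifted z (L_op n a) U + shifted z (L_op n a) V"
proof -
  obtain u\<^sub>1 u\<^sub>2 v\<^sub>1 v\<^sub>2 where UV: "U = (u\<^sub>1, u\<^sub>2)" "V = (v\<^sub>1, v\<^sub>2)" by (cases U, cases V)
  obtain f\<^sub>1 f\<^sub>2 where F: "shifted z (L_op n a) (u\<^sub>1, u\<^sub>2) = (f\<^sub>1, f\<^sub>2)" by fastforce
  obtain g\<^sub>1 g\<^sub>2 where G: "shifted z (L_op n a) (v\<^sub>1, v\<^sub>2) = (g\<^sub>1, g\<^sub>2)" by fastforce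
  have dom: "u\<^sub>1 \<in> sobolev (2*n)" "u\<^sub>2 \<in> sobolev (2*n)" "v\<^sub>1 \<in> sobolev (2*n)" "v\<^sub>2 \<in> sobolev (2*n)"
    using assms by (auto simp: UV L_dom_def)
  have "shifted z (L_op n a) (u\<^sub>1 + v\<^sub>1, u\<^sub>2 + v\<^sub>2) = (f\<^sub>1 + g\<^sub>1, f\<^sub>2 + g\<^sub>2)"
    using F G dom
    by (simp only: shifted_L_op_eq_iff[OF D] sobolev_add L2per_coeff_add) (simp add: algebra_simps)
  then show ?thesis by (simp add: UV F G)
qed

lemma shifted_L_op_scaleR:
  assumes D: "cond_D n a" and "U \<in> L_dom n"
  shows "shifted z (L_op n a) (r *\<^sub>R U) = r *\<^sub>R shifted z (L_op n a) U"
proof -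
  obtain u\<^sub>1 u\<^sub>2 where U: "U = (u\<^sub>1, u\<^sub>2)" by (cases U)
  obtain f\<^sub>1 f\<^sub>2 where F: "shifted z (L_op n a) (u\<^sub>1, u\<^sub>2) = (f\<^sub>1, f\<^sub>2)" by fastforce
  have dom: "u\<^sub>1 \<in> sobolev (2*n)" "u\<^sub>2 \<in> sobolev (2*n)"
    using assms by (auto simp: U L_dom_def)
  have "shifted z (L_op n a) (r *\<^sub>R u\<^sub>1, r *\<^sub>R u\<^sub>2) = (r *\<^sub>R f\<^sub>1, r *\<^sub>R f\<^sub>2)"
    using F dom
    by (simp only: shifted_L_op_eq_iff[OF D] sobolev_scaleR L2per_coeff_scaleR)
       (simp add: mult.left_commute flip: right_diff_distrib)
  then show ?thesis by (simp add: U F)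
qed

text \<open>
  A bound from below makes an operator injective and at the same time bounds its inverse.  Linearity is
  required on the subspace \<open>D\<close> only: an unbounded operator has no meaning outside its domain.
\<close>

lemma inverse_of_bounded_below:
  fixes T :: "'a::real_normed_vector \<Rightarrow> 'b::real_normed_vector"
  assumes D_add: "\<And>x y. x \<in> D \<Longrightarrow> y \<in> D \<Longrightarrow> x + y \<in> D"
    and D_scale: "\<And>r x. x \<in> D \<Longrightarrow> r *\<^sub>R x \<in> D"
    and add: "\<And>x y. x \<in> D \<Longrightarrow> y \<in> D \<Longrightarrow> T (x + y) = T x + T y"
    and scale: "\<And>r x. x \<in> D \<Longrightarrow> T (r *\<^sub>R x) = r *\<^sub>R T x"
    and surj: "\<And>y. \<exists>x\<in>D. T x = y"
    and bound: "\<And>x. x \<in> D \<Longrightarrow> norm x \<le> K * norm (T x)" and "K \<ge> 0"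
  shows "bij_betw T D UNIV" "bounded_linear (inv_into D T)" "onorm (inv_into D T) \<le> K"
proof -
  have inj: "inj_on T D"
  proof (rule inj_onI)
    fix x y assume xy: "x \<in> D" "y \<in> D" "T x = T y"
    have "x + (- 1) *\<^sub>R y \<in> D" "T (x + (- 1) *\<^sub>R y) = 0"
      using xy by (simp_all only: D_add D_scale add scale) simp
    then have "norm (x + (- 1) *\<^sub>R y) \<le> 0" using bound by fastforce
    then show "x = y" by simp
  qed
  show bij: "bij_betw T D UNIV"
    using inj surj by (auto simp: bij_betw_def image_iff) metis
  let ?R = "inv_into D T"
  have R: "?R y \<in> D" "T (?R y) = y" for y
    using bij by (auto simp: bij_betw_def intro: inv_into_into f_inv_into_f)
  have R_eq: "?R (T x) = x" if "x \<in> D" for x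
    using inj that by (rule inv_into_f_f)
  have norm: "norm (?R y) \<le> K * norm y" for y
    using bound[OF R(1)] R(2) by simp
  show "bounded_linear ?R"
  proof (rule bounded_linear_intro[where K = K])
    show "?R (x + y) = ?R x + ?R y" for x y
      using R_eq[OF D_add[OF R(1) R(1)], of x y] by (simp add: add R)
    show "?R (r *\<^sub>R x) = r *\<^sub>R ?R x" for r x
      using R_eq[OF D_scale[OF R(1)], of r x] by (simp add: scale R)
    show "norm (?R y) \<le> norm y * K" for y
      using norm[of y] by (simp add: mult.commute)
  qed
  show "onorm ?R \<le> K" by (rule onorm_bound[OF \<open>K \<ge> 0\<close> norm])
qed

theorem theorem6p1:
  fixes mL mc :: nat and b :: "real \<Rightarrow> nat \<Rightarrow> nat \<Rightarrow> real" and lc :: real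
  assumes "mL \<ge> 1"
    and "\<And>i k. i \<in> {1, 2} \<Longrightarrow> k \<le> 2*mL + 1 \<Longrightarrow> smooth (\<lambda>l. b l i k)"
    and "mc \<ge> 1"
    and "cond_D mL (b lc)"
    and "hopf_conditions mL b mc lc"
  shows "\<exists>\<omega>\<^sub>0 > 0. \<exists>C > 0. \<forall>\<omega>::real. \<bar>\<omega>\<bar> \<ge> \<omega>\<^sub>0 \<longrightarrow>
    \<i> * of_real \<omega> \<in> resolvent_set (L_dom mL) (L_op mL (b lc)) \<and>
    onorm (resolvent (L_dom mL) (L_op mL (b lc)) (\<i> * of_real \<omega>)) \<le> C / \<bar>\<omega>\<bar>"
proof -
  obtain \<omega>\<^sub>0 \<kappa> where "\<omega>\<^sub>0 > 0" "\<kappa> > 0"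
    and dom: "\<And>\<omega>. \<bar>\<omega>\<bar> \<ge> \<omega>\<^sub>0 \<Longrightarrow> diagonally_dominant mL (b lc) \<omega> \<kappa>"
    using eventually_diagonally_dominant[OF assms(1,4)] by blast
  have "\<i> * of_real \<omega> \<in> resolvent_set (L_dom mL) (L_op mL (b lc)) \<and>
      onorm (resolvent (L_dom mL) (L_op mL (b lc)) (\<i> * of_real \<omega>)) \<le> 4 / \<bar>\<omega>\<bar>"
    if \<omega>: "\<bar>\<omega>\<bar> \<ge> \<omega>\<^sub>0" for \<omega> :: real
  proof -
    have "\<omega> \<noteq> 0" using \<omega> \<open>\<omega>\<^sub>0 > 0\<close> by auto
    then have K: "0 \<le> 4 / \<bar>\<omega>\<bar>" by simp
    note inverse = inverse_of_bounded_below[of "L_dom mL" "shifted (\<i> * \<omega>) (L_op mL (b lc))" "4 / \<bar>\<omega>\<bar>",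
        OF L_dom_add L_dom_scaleR shifted_L_op_add[OF assms(4)] shifted_L_op_scaleR[OF assms(4)]
        L_op_resolvent_surj[OF assms(4) dom[OF \<omega>] \<open>\<kappa> > 0\<close> \<open>\<omega> \<noteq> 0\<close> assms(1)]
        L_op_resolvent_estimate[OF assms(4) dom[OF \<omega>] \<open>\<kappa> > 0\<close> \<open>\<omega> \<noteq> 0\<close> assms(1) _ refl] K]
    show ?thesis
      unfolding resolvent_set_def resolvent_def mem_Collect_eq
      by (intro conjI inverse)
  qed
  then show ?thesis using \<open>\<omega>\<^sub>0 > 0\<close> by (intro exI[of _ \<omega>\<^sub>0] exI[of _ 4] conjI allI impI) auto
qed

end
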